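(* There is a tomography algorithm that, given query access to an unknown unitary $Z\in\mathrm{U}(d)$ and parameters $\varepsilon,\eta>0$, applies $Z$ at most $O(d^2/\varepsilon^2)\cdot\log(1/\eta)$ times and outputs an estimate $V\in\mathrm{U}(d)$ satisfying $\operatorname{pudist}(Z,V)\le\varepsilon$ except with probability at most $\eta$. The algorithm uses only a $d$-dimensional Hilbert space (in particular only $n$ qubits when $d=2^n$).
   Context: $\operatorname{pudist}(U,V)=\min_{\phi\in\mathrm{U}(1)}\|\phi U-V\|_{\mathrm{op}}$, with $\|\cdot\|_{\mathrm{op}}$ the operator norm and $\mathrm{U}(1)$ the unit complex numbers.
   Formalization: The failure probability is restricted to 0 < η ≤ 1/2, because for η near or above 1 the bound O(d²/ε²)·log(1/η) falls below one query (or is negative) and the claim fails; the constant in O(·) is absolute. *)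

theory Defs
  imports "HOL-Analysis.Analysis" "Jordan_Normal_Form.Matrix"
begin

definition adj :: "complex mat \<Rightarrow> complex mat" where
  "adj A = mat (dim_col A) (dim_row A) (\<lambda>(i,j). cnj (A $$ (j,i)))"

definition unitary_mat :: "nat \<Rightarrow> complex mat \<Rightarrow> bool" where
  "unitary_mat d U \<longleftrightarrow> U \<in> carrier_mat d d \<and> adj U * U = 1\<^sub>m d"

definition vnorm :: "complex vec \<Rightarrow> real" where
  "vnorm v = sqrt (\<Sum>i<dim_vec v. (cmod (v $ i))^2)"

definition opnorm :: "nat \<Rightarrow> complex mat \<Rightarrow> real" where
  "opnorm d A = Sup {vnorm (A *\<^sub>v v) | v. v \<in> carrier_vec d \<and> vnorm v = 1}"

text \<open>pudist(U,V) = min over unit complex phi of the operator norm of phi U - V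
  (the minimum is attained, so it equals the infimum).\<close>
definition pudist :: "nat \<Rightarrow> complex mat \<Rightarrow> complex mat \<Rightarrow> real" where
  "pudist d U V = Inf {opnorm d (\<phi> \<cdot>\<^sub>m U - V) | \<phi>. cmod \<phi> = 1}"

definition mtrace :: "complex mat \<Rightarrow> complex" where
  "mtrace A = (\<Sum>i<dim_row A. A $$ (i,i))"

text \<open>Model of a query algorithm whose only quantum memory is C^d (plus unbounded
  classical memory = the record of all previous measurement outcomes).
  Start in the state |0><0|.  Then for steps i = 0, ..., queries: apply a quantum
  instrument (chosen adaptively from the classical history h) with outcomes
  0..<nout i h, outcome j having Kraus operators kraus i h j; after each step
  i < queries apply the unknown unitary Z.  Finally output (outp h) for the
  full classical history h.  Classical randomness can be realised by the instruments.\<close>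
record qalg =
  queries :: nat
  nout :: "nat \<Rightarrow> nat list \<Rightarrow> nat"
  kraus :: "nat \<Rightarrow> nat list \<Rightarrow> nat \<Rightarrow> complex mat list"
  outp :: "nat list \<Rightarrow> complex mat"

definition valid_hist :: "qalg \<Rightarrow> nat list \<Rightarrow> bool" where
  "valid_hist A h \<longleftrightarrow> (\<forall>i<length h. h ! i < nout A i (take i h))"

definition wf_alg :: "nat \<Rightarrow> qalg \<Rightarrow> bool" where
  "wf_alg d A \<longleftrightarrow>
     (\<forall>h. valid_hist A h \<and> length h \<le> queries A \<longrightarrow>
        (\<forall>j<nout A (length h) h. \<forall>K\<in>set (kraus A (length h) h j). K \<in> carrier_mat d d) \<and>
        (\<forall>a<d. \<forall>b<d. (\<Sum>j<nout A (length h) h.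
              sum_list (map (\<lambda>K. (adj K * K) $$ (a,b)) (kraus A (length h) h j)))
            = (1\<^sub>m d :: complex mat) $$ (a,b))) \<and>
     (\<forall>h. valid_hist A h \<and> length h = Suc (queries A) \<longrightarrow> unitary_mat d (outp A h))"

definition init_state :: "nat \<Rightarrow> complex mat" where
  "init_state d = mat d d (\<lambda>(a,b). if a = 0 \<and> b = 0 then 1 else 0)"

definition apply_kraus :: "nat \<Rightarrow> complex mat list \<Rightarrow> complex mat \<Rightarrow> complex mat" where
  "apply_kraus d Ks \<sigma> = mat d d (\<lambda>(a,b). sum_list (map (\<lambda>K. (K * \<sigma> * adj K) $$ (a,b)) Ks))"

text \<open>Unnormalised post-measurement state for a reversed history.\<close>
fun run_rev :: "nat \<Rightarrow> complex mat \<Rightarrow> qalg \<Rightarrow> nat list \<Rightarrow> complex mat" where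
  "run_rev d Z A [] = init_state d"
| "run_rev d Z A (j # hr) =
     (let i = length hr;
          \<sigma> = apply_kraus d (kraus A i (rev hr) j) (run_rev d Z A hr)
      in if i < queries A then Z * \<sigma> * adj Z else \<sigma>)"

definition run :: "nat \<Rightarrow> complex mat \<Rightarrow> qalg \<Rightarrow> nat list \<Rightarrow> complex mat" where
  "run d Z A h = run_rev d Z A (rev h)"

definition fail_prob :: "nat \<Rightarrow> complex mat \<Rightarrow> qalg \<Rightarrow> real \<Rightarrow> real" where
  "fail_prob d Z A \<epsilon> =
     (\<Sum>h\<in>{h. valid_hist A h \<and> length h = Suc (queries A)}.
        if pudist d Z (outp A h) > \<epsilon> then Re (mtrace (run d Z A h)) else 0)"

end

theory Submission
  imports Defs "Jordan_Normal_Form.Determinant"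
begin

text \<open>
  Prepare a vector \<open>b\<close>, apply \<open>Z\<close> and measure a vector \<open>a\<close>, where the entries of \<open>a\<close> and \<open>b\<close>
  are independent copies of a finitely supported variable with the fourth moments of a complex
  Gaussian. Then \<open>(b, a)\<close> has density \<open>\<bar>\<langle>a, Z b\<rangle>\<bar>\<^sup>2 / d\<close> with respect to the product measure, and
  for every reference \<open>R\<close> and test matrix \<open>W\<close> the mean of \<open>\<langle>a, R b\<rangle> \<cdot> cnj \<langle>a, W b\<rangle>\<close> is
  \<open>(\<langle>W, Z\<rangle> \<langle>Z, R\<rangle> + (d + 2) \<langle>W, R\<rangle>) / d\<close>, where matrices are paired by the Hilbert--Schmidt product.

  With \<open>W = R\<close> ranging over a Frobenius net of the unitary group of size \<open>exp O(d\<^sup>2)\<close>, \<open>O(d\<^sup>2)\<close> samples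
  find an \<open>R\<close> with \<open>\<bar>\<langle>Z, R\<rangle>\<bar> \<ge> d / 2\<close>. With this \<open>R\<close> and \<open>W = u v\<^sup>*\<close>, where \<open>u, v\<close> range over a net
  of the unit sphere of size \<open>exp O(d)\<close>, a second batch of samples determines all
  \<open>\<langle>u, Z v\<rangle>\<close> up to a common factor of modulus at least \<open>1/2\<close>, and hence \<open>Z\<close> in operator norm up to a phase.
  The statistics are heavy-tailed, but the clamped empirical mean has sub-Gaussian deviations
  as soon as the variance is bounded, and the variance of the second statistic is only \<open>O(d)\<close>.
  This gives \<open>O(d\<^sup>2 / \<epsilon>\<^sup>2)\<close> samples without logarithmic loss.
\<close>

section \<open>Moments of random words\<close>

text \<open>A uniformly chosen index gives \<open>\<xi>\<close> with \<open>E \<xi> = E \<xi>\<^sup>2 = 0\<close>, \<open>E \<bar>\<xi>\<bar>\<^sup>2 = 1\<close> and \<open>E \<bar>\<xi>\<bar>\<^sup>4 = 2\<close>.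
  The value \<open>0\<close> is included to obtain this fourth moment.\<close>
definition letter :: "nat \<Rightarrow> complex" where
  "letter k = (if k < 4 then complex_of_real (sqrt 2) * \<i> ^ k else 0)"

definition words :: "nat \<Rightarrow> (nat \<Rightarrow> nat) set" where
  "words d = PiE {..<d} (\<lambda>_. {..<8})"

definition wvec :: "(nat \<Rightarrow> nat) \<Rightarrow> nat \<Rightarrow> complex" where
  "wvec a i = letter (a i)"

text \<open>Expectation over a uniformly random word. The codomain is polymorphic because exact
  moments are computed over the complex numbers and bounds over the reals.\<close>

definition wavg :: "nat \<Rightarrow> ((nat \<Rightarrow> complex) \<Rightarrow> 'a) \<Rightarrow> 'a::real_normed_field" where
  "wavg d f = (\<Sum>a\<in>words d. f (wvec a)) / 8 ^ d"

definition ip :: "nat \<Rightarrow> (nat \<Rightarrow> complex) \<Rightarrow> (nat \<Rightarrow> complex) \<Rightarrow> complex" where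
  "ip d x y = (\<Sum>i<d. cnj (x i) * y i)"

definition mv :: "nat \<Rightarrow> (nat \<Rightarrow> nat \<Rightarrow> complex) \<Rightarrow> (nat \<Rightarrow> complex) \<Rightarrow> nat \<Rightarrow> complex" where
  "mv d M v i = (\<Sum>j<d. M i j * v j)"

definition hs :: "nat \<Rightarrow> (nat \<Rightarrow> nat \<Rightarrow> complex) \<Rightarrow> (nat \<Rightarrow> nat \<Rightarrow> complex) \<Rightarrow> complex" where
  "hs d A B = (\<Sum>i<d. \<Sum>m<d. cnj (A m i) * B m i)"

text \<open>Orthonormality of columns and of rows are both recorded: columns give preservation of
  norms, while the estimator mean also contracts \<open>Z\<close> with its adjoint along the
  rows.\<close>

definition unitary_fun :: "nat \<Rightarrow> (nat \<Rightarrow> nat \<Rightarrow> complex) \<Rightarrow> bool" where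
  "unitary_fun d Z \<longleftrightarrow>
     (\<forall>i<d. \<forall>j<d. (\<Sum>m<d. cnj (Z m i) * Z m j) = of_bool (i = j)) \<and>
     (\<forall>i<d. \<forall>j<d. (\<Sum>m<d. Z i m * cnj (Z j m)) = of_bool (i = j))"

lemma finite_words [simp]: "finite (words d)"
  unfolding words_def by (simp add: finite_PiE)

lemma card_words [simp]: "card (words d) = 8 ^ d"
  unfolding words_def by (simp add: card_PiE)

lemma wavg_const [simp]: "wavg d (\<lambda>_. c) = c"
  by (simp add: wavg_def)

lemma wavg_add: "wavg d (\<lambda>a. f a + g a) = wavg d f + wavg d g"
  by (simp add: wavg_def sum.distrib add_divide_distrib)

lemma wavg_cmult: "wavg d (\<lambda>a. c * f a) = c * wavg d f"
  by (simp add: wavg_def sum_distrib_left)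

lemma wavg_sum: "wavg d (\<lambda>a. \<Sum>i\<in>I. f i a) = (\<Sum>i\<in>I. wavg d (f i))"
  unfolding wavg_def sum_divide_distrib[symmetric] by (subst sum.swap) simp

lemma wavg_mono:
  fixes f g :: "(nat \<Rightarrow> complex) \<Rightarrow> real"
  assumes "\<And>a. a \<in> words d \<Longrightarrow> f (wvec a) \<le> g (wvec a)"
  shows "wavg d f \<le> wavg d g"
  unfolding wavg_def by (intro divide_right_mono sum_mono assms) auto

lemma wavg_of_real: "wavg d (\<lambda>a. of_real (f a)) = of_real (wavg d f)"
  by (simp add: wavg_def)

lemma wavg_prod:
  "wavg d (\<lambda>a. \<Prod>j<d. g j (a j)) = (\<Prod>j<d. (\<Sum>k<8. g j (letter k)) / 8)"
proof -
  have "(\<Sum>a\<in>words d. \<Prod>j<d. g j (wvec a j)) = (\<Prod>j<d. \<Sum>k<8. g j (letter k))"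
    unfolding words_def wvec_def by (subst prod_sum_PiE) auto
  then show ?thesis by (simp add: wavg_def prod_dividef)
qed

text \<open>The Booleans select which factors occur, so one identity covers all moments up to two
  plain and two conjugated factors. The phases are uniform fourth roots of unity, which cancel
  unless both kinds of factor are equally many; modulus \<open>sqrt 2\<close> with probability 1/2
  gives 1 and 2 in the balanced cases.\<close>

lemma letter_moment:
  "(\<Sum>k<8. (if p then cnj (letter k) else 1) * (if q then letter k else 1)
      * (if r then cnj (letter k) else 1) * (if s then letter k else 1)) / 8
   = (if of_bool p + of_bool r = (of_bool q + of_bool s :: nat)
      then (if p \<and> r then 2 else 1) else 0)"
proof -
  have e: "{..<8::nat} = {0,1,2,3,4,5,6,7}" by auto
  have s2: "complex_of_real (sqrt 2) * complex_of_real (sqrt 2) = 2"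
    by (metis of_real_mult of_real_numeral real_sqrt_mult_self abs_numeral)
  have s2': "complex_of_real (sqrt 2) * (complex_of_real (sqrt 2) * x) = 2 * x" for x
    by (simp add: mult.assoc[symmetric] s2)
  show ?thesis
    by (cases p; cases q; cases r; cases s)
       (simp_all add: e letter_def power2_eq_square power3_eq_cube s2 s2' algebra_simps)
qed

text \<open>Wick's formula, as for complex Gaussians: coordinates are independent, so the monomial
  factors into letter moments.\<close>

lemma wavg_quartic_monomial:
  assumes "i < d" "j < d" "k < d" "l < d"
  shows "wavg d (\<lambda>a. cnj (a i) * a j * cnj (a k) * a l)
    = of_bool (i = j \<and> k = l) + of_bool (i = l \<and> k = j)"
proof -
  have mono: "cnj (a i) * a j * cnj (a k) * a l =
     (\<Prod>m<d. (if m = i then cnj (a m) else 1) * (if m = j then a m else 1)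
      * (if m = k then cnj (a m) else 1) * (if m = l then a m else 1))" for a :: "nat \<Rightarrow> complex"
    using assms by (simp add: prod.distrib)
  define F :: "nat \<Rightarrow> complex" where
    "F m = (if of_bool (m = i) + of_bool (m = k) = (of_bool (m = j) + of_bool (m = l) :: nat)
      then (if m = i \<and> m = k then 2 else 1) else 0)" for m
  have "wavg d (\<lambda>a. cnj (a i) * a j * cnj (a k) * a l) = (\<Prod>m<d. F m)"
    unfolding F_def letter_moment[symmetric]
    by (subst ext[OF mono], rule wavg_prod[of d "\<lambda>m x. (if m = i then cnj x else 1) * (if m = j then x else 1)
      * (if m = k then cnj x else 1) * (if m = l then x else 1)"])
  also have "\<dots> = of_bool (i = j \<and> k = l) + of_bool (i = l \<and> k = j)"
  proof (cases "(i = j \<and> k = l) \<or> (i = l \<and> k = j)")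
    case True
    \<comment> \<open>Only a coordinate carrying all four factors contributes something other than
      1; its fourth moment 2 counts the two pairings, both of which then hold.\<close>
    have "(\<Prod>m<d. F m) = (\<Prod>m<d. if m = i then (if i = k then 2 else 1) else 1)"
      using True by (intro prod.cong) (auto simp: F_def)
    also have "\<dots> = (if i = k then 2 else 1)" using assms by simp
    finally show ?thesis using True by auto
  next
    case False
    \<comment> \<open>Without a pairing, \<open>i\<close> or \<open>k\<close> is a coordinate whose
      plain and conjugated factors do not balance.\<close>
    have "F i = 0 \<or> F k = 0"
    proof (cases "i = j \<or> i = l")
      case True
      then have "F k = 0" using False by (cases "k = i") (auto simp: F_def)
      then show ?thesis ..
    next
      case False
      then have "F i = 0" by (simp add: F_def)
      then show ?thesis ..
    qed
    then have F0: "(\<Prod>m<d. F m) = 0" using assms by auto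
    have "\<not> (i = j \<and> k = l)" "\<not> (i = l \<and> k = j)" using False by blast+
    then show ?thesis unfolding F0 by (simp only: of_bool_eq add_0_left)
  qed
  finally show ?thesis .
qed

lemma wavg_quadratic_monomial:
  assumes "i < d" "j < d"
  shows "wavg d (\<lambda>a. cnj (a i) * a j) = of_bool (i = j)"
proof -
  have mono: "cnj (a i) * a j =
     (\<Prod>m<d. (if m = i then cnj (a m) else 1) * (if m = j then a m else 1)
      * (if False then cnj (a m) else 1) * (if False then a m else 1))" for a :: "nat \<Rightarrow> complex"
    using assms by (simp add: prod.distrib)
  have "wavg d (\<lambda>a. cnj (a i) * a j) =
      (\<Prod>m<d. if of_bool (m = i) + of_bool False = (of_bool (m = j) + of_bool False :: nat)
      then (if m = i \<and> False then 2 else 1) else 0)"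
    unfolding letter_moment[symmetric]
    by (subst ext[OF mono], rule wavg_prod[of d "\<lambda>m x. (if m = i then cnj x else 1) * (if m = j then x else 1)
      * (if False then cnj x else 1) * (if False then x else 1)"])
  also have "\<dots> = of_bool (i = j)"
  proof (cases "i = j")
    case True then show ?thesis by (simp add: prod.neutral)
  next
    case False
    have "(\<Prod>m<d. if of_bool (m = i) + of_bool False = (of_bool (m = j) + of_bool False :: nat)
      then (if m = i \<and> False then 2 else 1) else (0::complex)) = 0"
      using assms False by (intro prod_zero) (auto intro!: bexI[of _ i])
    then show ?thesis using False by simp
  qed
  finally show ?thesis .
qed

text \<open>The two Wick pairings, summed against coefficients, give the product of the traces and
  the trace of the product.\<close>

lemma wavg_quartic_form:
  "wavg d (\<lambda>a. (\<Sum>i<d. \<Sum>j<d. A i j * (cnj (a i) * a j)) * (\<Sum>k<d. \<Sum>l<d. B k l * (cnj (a k) * a l)))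
   = (\<Sum>i<d. A i i) * (\<Sum>k<d. B k k) + (\<Sum>i<d. \<Sum>j<d. A i j * B j i)"
proof -
  have "wavg d (\<lambda>a. (\<Sum>i<d. \<Sum>j<d. A i j * (cnj (a i) * a j)) * (\<Sum>k<d. \<Sum>l<d. B k l * (cnj (a k) * a l)))
    = wavg d (\<lambda>a. \<Sum>i<d. \<Sum>j<d. \<Sum>k<d. \<Sum>l<d. (A i j * B k l) * (cnj (a i) * a j * cnj (a k) * a l))"
    by (intro arg_cong[where f="wavg d"] ext, simp only: sum_distrib_right, simp only: sum_distrib_left)
       (intro sum.cong refl, simp only: mult_ac)
  also have "\<dots> = (\<Sum>i<d. \<Sum>j<d. \<Sum>k<d. \<Sum>l<d. (A i j * B k l) *
        (of_bool (i = j \<and> k = l) + of_bool (i = l \<and> k = j)))"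
    unfolding wavg_sum wavg_cmult by (intro sum.cong refl) (simp add: wavg_quartic_monomial)
  also have "\<dots> = (\<Sum>i<d. \<Sum>j<d. \<Sum>k<d. \<Sum>l<d. if l = k then (if j = i then A i j * B k l else 0) else 0)
      + (\<Sum>i<d. \<Sum>j<d. \<Sum>k<d. \<Sum>l<d. if l = i then (if k = j then A i j * B k l else 0) else 0)"
    unfolding sum.distrib[symmetric] by (intro sum.cong refl) auto
  also have "(\<Sum>i<d. \<Sum>j<d. \<Sum>k<d. \<Sum>l<d. if l = k then (if j = i then A i j * B k l else 0) else 0)
     = (\<Sum>i<d. \<Sum>k<d. \<Sum>j<d. if j = i then A i j * B k k else 0)"
    by (subst (2) sum.swap) (intro sum.cong refl, simp)
  also have "\<dots> = (\<Sum>i<d. A i i) * (\<Sum>k<d. B k k)"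
    by (simp add: sum_product)
  also have "(\<Sum>i<d. \<Sum>j<d. \<Sum>k<d. \<Sum>l<d. if l = i then (if k = j then A i j * B k l else 0) else 0)
     = (\<Sum>i<d. \<Sum>j<d. A i j * B j i)"
    by (intro sum.cong refl) simp
  finally show ?thesis .
qed

lemma ip_mult_cnj_ip:
  "ip d a z * cnj (ip d a w) = (\<Sum>i<d. \<Sum>j<d. (z i * cnj (w j)) * (cnj (a i) * a j))"
  unfolding ip_def cnj_sum sum_product by (intro sum.cong refl) (simp add: algebra_simps)

lemma wavg_ip2: "wavg d (\<lambda>a. ip d a z * cnj (ip d a w)) = ip d w z"
proof -
  have "wavg d (\<lambda>a. ip d a z * cnj (ip d a w)) = (\<Sum>i<d. \<Sum>j<d. (z i * cnj (w j)) * of_bool (i = j))"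
    unfolding ip_mult_cnj_ip wavg_sum wavg_cmult
    by (intro sum.cong refl) (simp add: wavg_quadratic_monomial)
  also have "\<dots> = ip d w z"
    by (simp add: ip_def of_bool_def if_distrib mult.commute cong: if_cong)
  finally show ?thesis .
qed

lemma wavg_ip4:
  "wavg d (\<lambda>a. (ip d a z * cnj (ip d a y)) * (ip d a r * cnj (ip d a w)))
    = ip d y z * ip d w r + ip d w z * ip d y r"
proof -
  have "(\<Sum>i<d. \<Sum>j<d. z i * cnj (y j) * (r j * cnj (w i))) = ip d w z * ip d y r"
    unfolding ip_def sum_product by (intro sum.cong refl) (simp add: algebra_simps)
  moreover have "(\<Sum>i<d. z i * cnj (y i)) = ip d y z" "(\<Sum>i<d. r i * cnj (w i)) = ip d w r"
    by (simp_all add: ip_def mult.commute)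
  ultimately show ?thesis
    unfolding ip_mult_cnj_ip wavg_quartic_form by simp
qed

lemma ip_mv_mv:
  "ip d (mv d A b) (mv d B b) = (\<Sum>i<d. \<Sum>j<d. (\<Sum>m<d. cnj (A m i) * B m j) * (cnj (b i) * b j))"
proof -
  have "ip d (mv d A b) (mv d B b)
      = (\<Sum>m<d. \<Sum>i<d. \<Sum>j<d. cnj (A m i) * B m j * (cnj (b i) * b j))"
    unfolding ip_def mv_def cnj_sum sum_product by (intro sum.cong refl) (simp add: algebra_simps)
  also have "\<dots> = (\<Sum>i<d. \<Sum>j<d. \<Sum>m<d. cnj (A m i) * B m j * (cnj (b i) * b j))"
    by (subst sum.swap) (rule sum.cong[OF refl], rule sum.swap)
  finally show ?thesis by (simp add: sum_distrib_right)
qed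

text \<open>Averaging over \<open>a\<close> by \<open>wavg_ip4\<close> leaves two products of
  quadratic forms in \<open>b\<close>, and each is averaged by \<open>wavg_quartic_form\<close>. The
  first pairs the Gram matrix of \<open>Z\<close>, the identity, with that of \<open>W\<close> and
  \<open>R\<close> and yields \<open>of_nat d + 1\<close> copies of \<open>hs d W R\<close>; the
  second yields the signal and one more copy.\<close>

lemma wavg_estimator_mean:
  assumes Z: "unitary_fun d Z"
  shows "wavg d (\<lambda>b. wavg d (\<lambda>a. (ip d a (mv d Z b) * cnj (ip d a (mv d Z b)))
            * (ip d a (mv d R b) * cnj (ip d a (mv d W b)))))
    = hs d W Z * hs d Z R + (of_nat d + 2) * hs d W R"
proof -
  define G where "G A B i j = (\<Sum>m<d. cnj (A m i) * B m j)" for A B :: "nat \<Rightarrow> nat \<Rightarrow> complex" and i j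
  have tr: "(\<Sum>i<d. G A B i i) = hs d A B" for A B
    by (simp add: G_def hs_def)
  have ZZ: "G Z Z i j = of_bool (i = j)" if "i < d" "j < d" for i j
    using Z that by (simp add: G_def unitary_fun_def)
  have 1: "(\<Sum>i<d. \<Sum>j<d. G Z Z i j * G W R j i) = hs d W R"
  proof -
    have "(\<Sum>i<d. \<Sum>j<d. G Z Z i j * G W R j i) = (\<Sum>i<d. \<Sum>j<d. if j = i then G W R j i else 0)"
      by (intro sum.cong refl) (simp add: ZZ)
    then show ?thesis by (simp add: tr)
  qed
  have 2: "(\<Sum>i<d. G Z Z i i) = of_nat d"
    by (simp add: ZZ)
  \<comment> \<open>The row relations act here: the sum over \<open>j\<close> contracts
    \<open>Z\<close> with its adjoint and identifies \<open>m\<close> with \<open>n\<close>.\<close>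
  have 3: "(\<Sum>i<d. \<Sum>j<d. G W Z i j * G Z R j i) = hs d W R"
  proof -
    have "(\<Sum>j<d. G W Z i j * G Z R j i) = (\<Sum>m<d. cnj (W m i) * R m i)" if "i < d" for i
    proof -
      have "(\<Sum>j<d. G W Z i j * G Z R j i)
          = (\<Sum>j<d. \<Sum>m<d. \<Sum>n<d. (cnj (W m i) * R n i) * (Z m j * cnj (Z n j)))"
        unfolding G_def sum_product by (intro sum.cong refl) (simp add: algebra_simps)
      also have "\<dots> = (\<Sum>m<d. \<Sum>n<d. \<Sum>j<d. (cnj (W m i) * R n i) * (Z m j * cnj (Z n j)))"
        by (subst sum.swap) (rule sum.cong[OF refl], rule sum.swap)
      also have "\<dots> = (\<Sum>m<d. \<Sum>n<d. (cnj (W m i) * R n i) * of_bool (m = n))"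
        using Z by (intro sum.cong refl) (simp add: unitary_fun_def sum_distrib_left[symmetric])
      also have "\<dots> = (\<Sum>m<d. cnj (W m i) * R m i)"
        by (intro sum.cong refl) (simp add: of_bool_def if_distrib cong: if_cong)
      finally show ?thesis .
    qed
    then show ?thesis by (simp add: hs_def)
  qed
  have ip_G: "ip d (mv d A b) (mv d B b) = (\<Sum>i<d. \<Sum>j<d. G A B i j * (cnj (b i) * b j))" for A B b
    by (simp only: ip_mv_mv G_def)
  show ?thesis
    unfolding wavg_ip4 wavg_add ip_G wavg_quartic_form 1 2 3 tr
    by (simp add: algebra_simps)
qed

section \<open>Clamped means of independent samples\<close>

definition tuples :: "'a set \<Rightarrow> nat \<Rightarrow> 'a list set" where
  "tuples S n = {xs. set xs \<subseteq> S \<and> length xs = n}"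

lemma tuples_0 [simp]: "tuples S 0 = {[]}"
  by (auto simp: tuples_def)

lemma sum_tuples_Suc:
  "(\<Sum>xs\<in>tuples S (Suc n). f xs) = (\<Sum>x\<in>S. \<Sum>xs\<in>tuples S n. f (x # xs))"
proof -
  have "tuples S (Suc n) = (\<lambda>(x, xs). x # xs) ` (S \<times> tuples S n)"
    by (auto simp: tuples_def length_Suc_conv image_iff)
  then have "(\<Sum>xs\<in>tuples S (Suc n). f xs) = (\<Sum>(x, xs)\<in>S \<times> tuples S n. f (x # xs))"
    by (simp add: sum.reindex inj_on_def case_prod_unfold)
  then show ?thesis by (simp add: sum.cartesian_product)
qed

lemma sum_tuples_add:
  "(\<Sum>xs\<in>tuples S (m + n). f xs) = (\<Sum>xs\<in>tuples S m. \<Sum>ys\<in>tuples S n. f (xs @ ys))"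
  by (induction m arbitrary: f) (simp_all add: sum_tuples_Suc)

lemma sum_tuples_prod_list:
  fixes p :: "'a \<Rightarrow> 'b::comm_semiring_1"
  shows "(\<Sum>xs\<in>tuples S n. prod_list (map p xs)) = (sum p S) ^ n"
  by (induction n) (simp_all add: sum_tuples_Suc sum_distrib_left[symmetric] sum_distrib_right)

text \<open>Probabilities are finite sums of product weights rather than measures, since the failure
  probability of a query algorithm is itself a finite sum over histories.\<close>

definition iid_prob :: "'a set \<Rightarrow> ('a \<Rightarrow> real) \<Rightarrow> nat \<Rightarrow> ('a list \<Rightarrow> bool) \<Rightarrow> real" where
  "iid_prob S p n E = (\<Sum>xs\<in>tuples S n. prod_list (map p xs) * of_bool (E xs))"

lemma prod_list_map_nonneg:
  fixes p :: "'a \<Rightarrow> real"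
  assumes "\<And>x. x \<in> S \<Longrightarrow> 0 \<le> p x" "xs \<in> tuples S n"
  shows "0 \<le> prod_list (map p xs)"
proof -
  have "\<forall>x\<in>set xs. 0 \<le> p x" using assms by (auto simp: tuples_def)
  then show ?thesis by (induction xs) auto
qed

lemma iid_prob_mono:
  assumes "\<And>x. x \<in> S \<Longrightarrow> 0 \<le> p x" "\<And>xs. xs \<in> tuples S n \<Longrightarrow> E xs \<Longrightarrow> F xs"
  shows "iid_prob S p n E \<le> iid_prob S p n F"
  unfolding iid_prob_def using assms
  by (intro sum_mono mult_left_mono prod_list_map_nonneg[of S p _ n]) (auto simp: of_bool_def)

lemma iid_prob_disj:
  assumes "\<And>x. x \<in> S \<Longrightarrow> 0 \<le> p x"
  shows "iid_prob S p n (\<lambda>xs. E xs \<or> F xs) \<le> iid_prob S p n E + iid_prob S p n F"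
  unfolding iid_prob_def sum.distrib[symmetric]
proof (rule sum_mono)
  fix xs assume "xs \<in> tuples S n"
  then have "0 \<le> prod_list (map p xs)" using assms by (intro prod_list_map_nonneg[of S p _ n]) auto
  then show "prod_list (map p xs) * of_bool (E xs \<or> F xs) \<le>
     prod_list (map p xs) * of_bool (E xs) + prod_list (map p xs) * of_bool (F xs)"
    by (auto simp: of_bool_def)
qed

lemma iid_prob_union_bound:
  assumes "\<And>x. x \<in> S \<Longrightarrow> 0 \<le> p x" "finite I" "\<And>i. i \<in> I \<Longrightarrow> iid_prob S p n (E i) \<le> \<delta>"
  shows "iid_prob S p n (\<lambda>xs. \<exists>i\<in>I. E i xs) \<le> real (card I) * \<delta>"
  using assms(2,3)
proof (induction I rule: finite_induct)
  case empty
  show ?case by (simp add: iid_prob_def)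
next
  case (insert j I)
  have "iid_prob S p n (\<lambda>xs. \<exists>i\<in>insert j I. E i xs) = iid_prob S p n (\<lambda>xs. E j xs \<or> (\<exists>i\<in>I. E i xs))"
    by simp
  also have "\<dots> \<le> iid_prob S p n (E j) + iid_prob S p n (\<lambda>xs. \<exists>i\<in>I. E i xs)"
    using assms(1) by (rule iid_prob_disj)
  also have "\<dots> \<le> \<delta> + real (card I) * \<delta>"
    using insert by (intro add_mono) auto
  finally show ?case using insert by (simp add: algebra_simps)
qed

lemma iid_prob_le_1:
  assumes "\<And>x. x \<in> S \<Longrightarrow> 0 \<le> p x" "sum p S = 1"
  shows "iid_prob S p n E \<le> 1"
proof -
  have "iid_prob S p n E \<le> iid_prob S p n (\<lambda>_. True)" using assms(1) by (rule iid_prob_mono) auto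
  also have "\<dots> = 1" by (simp add: iid_prob_def sum_tuples_prod_list assms)
  finally show ?thesis .
qed

text \<open>Conditioning on the first batch. The event \<open>E2 xs\<close> may depend on that
  batch, as it must when the second statistic is built from an already chosen reference; on
  \<open>E1\<close> the inner probability is bounded by 1.\<close>

lemma iid_prob_two_stage:
  assumes p: "\<And>x. x \<in> S \<Longrightarrow> 0 \<le> p x" "sum p S = 1"
    and E1: "iid_prob S p m E1 \<le> \<delta>1"
    and E2: "\<And>xs. xs \<in> tuples S m \<Longrightarrow> \<not> E1 xs \<Longrightarrow> iid_prob S p n (E2 xs) \<le> \<delta>2"
    and E: "\<And>xs ys. xs \<in> tuples S m \<Longrightarrow> ys \<in> tuples S n \<Longrightarrow> E (xs @ ys) \<Longrightarrow> E1 xs \<or> E2 xs ys"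
    and "0 \<le> \<delta>2"
  shows "iid_prob S p (m + n) E \<le> \<delta>1 + \<delta>2"
proof -
  have "iid_prob S p (m + n) E
      = (\<Sum>xs\<in>tuples S m. prod_list (map p xs) * iid_prob S p n (\<lambda>ys. E (xs @ ys)))"
    by (simp add: iid_prob_def sum_tuples_add sum_distrib_left mult.assoc)
  also have "\<dots> \<le> (\<Sum>xs\<in>tuples S m. prod_list (map p xs) * (of_bool (E1 xs) + \<delta>2))"
  proof (rule sum_mono, rule mult_left_mono)
    fix xs assume xs: "xs \<in> tuples S m"
    show "0 \<le> prod_list (map p xs)" using p(1) xs by (rule prod_list_map_nonneg)
    show "iid_prob S p n (\<lambda>ys. E (xs @ ys)) \<le> of_bool (E1 xs) + \<delta>2"
    proof (cases "E1 xs")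
      case True
      have "iid_prob S p n (\<lambda>ys. E (xs @ ys)) \<le> 1" using p by (rule iid_prob_le_1)
      then show ?thesis using True \<open>0 \<le> \<delta>2\<close> by simp
    next
      case False
      have "iid_prob S p n (\<lambda>ys. E (xs @ ys)) \<le> iid_prob S p n (E2 xs)"
        using p(1) by (rule iid_prob_mono) (use E xs False in auto)
      then show ?thesis using E2[OF xs False] False by simp
    qed
  qed
  also have "\<dots> = iid_prob S p m E1 + \<delta>2"
    by (simp add: iid_prob_def distrib_left sum.distrib sum_distrib_right[symmetric]
        sum_tuples_prod_list p)
  finally show ?thesis using E1 by simp
qed

section \<open>Chernoff bounds for clamped sums\<close>

lemma exp_le_quadratic:
  fixes y :: real
  assumes "\<bar>y\<bar> \<le> 1"
  shows "exp y \<le> 1 + y + y\<^sup>2"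
proof (cases "0 \<le> y")
  case True
  then show ?thesis using exp_bound assms by auto
next
  case False
  \<comment> \<open>For negative \<open>y\<close>, \<open>exp y\<close> is at most 1/(1 - y), while
    (1 + y + y^2)(1 - y) = 1 - y^3 is at least 1.\<close>
  have "1 - y \<le> exp (- y)" using exp_ge_add_one_self[of "-y"] by simp
  then have "exp y * (1 - y) \<le> 1"
    by (metis exp_ge_zero exp_minus_inverse mult_left_mono)
  also have "1 \<le> (1 + y + y\<^sup>2) * (1 - y)"
  proof -
    have "(1 + y + y\<^sup>2) * (1 - y) = 1 + y\<^sup>2 * (- y)" by (simp add: algebra_simps power2_eq_square)
    moreover have "0 \<le> y\<^sup>2 * (- y)" using False by (intro mult_nonneg_nonneg) auto
    ultimately show ?thesis by linarith
  qed
  finally show ?thesis using False by (simp add: mult_le_cancel_right)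
qed

definition clamp_at :: "real \<Rightarrow> real \<Rightarrow> real" where
  "clamp_at L x = max (- L) (min L x)"

definition clamped_sum :: "real \<Rightarrow> ('a \<Rightarrow> real) \<Rightarrow> 'a list \<Rightarrow> real" where
  "clamped_sum L X xs = (\<Sum>x\<leftarrow>xs. clamp_at L (X x))"

text \<open>Clamping raises \<open>x\<close> only below \<open>- L\<close>, by less than |x|, hence
  by less than x^2 / L. On average the upward bias is at most the second moment divided by
  \<open>L\<close>.\<close>

lemma clamp_at_le:
  assumes "0 < L" shows "clamp_at L x \<le> x + x\<^sup>2 / L"
proof (cases "x < - L")
  case True
  then have "(-x) * L \<le> (-x) * (-x)" using assms by (intro mult_left_mono) auto
  then have "- x \<le> x\<^sup>2 / L" using assms by (simp add: field_simps power2_eq_square)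
  then show ?thesis using True assms by (simp add: clamp_at_def)
next
  case False
  have "clamp_at L x \<le> x" using False by (simp add: clamp_at_def)
  moreover have "0 \<le> x\<^sup>2 / L" using assms by simp
  ultimately show ?thesis by linarith
qed

text \<open>Chernoff's method. Once the summands are clamped, their exponential moment is controlled
  by the second moment alone, however heavy the tails of \<open>X\<close> are.\<close>

lemma clamped_sum_upper_tail:
  fixes p X :: "'a \<Rightarrow> real"
  assumes p: "\<And>x. x \<in> S \<Longrightarrow> 0 \<le> p x" "sum p S = 1"
    and m2: "(\<Sum>x\<in>S. p x * (X x)\<^sup>2) \<le> v" and pos: "0 < v" "0 < t"
    and m: "(\<Sum>x\<in>S. p x * X x) = m"
  shows "iid_prob S p n (\<lambda>xs. real n * (m + 3/2 * t) < clamped_sum (2 * v / t) X xs)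
         \<le> exp (- real n * t\<^sup>2 / (4 * v))"
proof -
  \<comment> \<open>The level is the reciprocal of the Chernoff parameter \<open>l\<close>, so
    exponents stay in [-1, 1]. The bias \<open>v / L\<close> is \<open>t / 2\<close>, whence the
    threshold \<open>3/2 * t\<close>; the exponent per sample becomes 2 l^2 v - (3/2) l t = - t^2 /
    (4 v).\<close>
  define L where "L = 2 * v / t"
  define l where "l = t / (2 * v)"
  have L: "0 < L" "0 < l" "l * L = 1" using pos by (auto simp: L_def l_def)
  define Y where "Y x = clamp_at L (X x)" for x
  have Yb: "\<bar>l * Y x\<bar> \<le> 1" for x
  proof -
    have "\<bar>Y x\<bar> \<le> L" using L by (auto simp: Y_def clamp_at_def)
    then have "l * \<bar>Y x\<bar> \<le> l * L" using L by (intro mult_left_mono) auto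
    then show ?thesis using L by (simp add: abs_mult)
  qed
  have Y2: "(Y x)\<^sup>2 \<le> (X x)\<^sup>2" for x
    using L by (intro abs_le_square_iff[THEN iffD1]) (auto simp: Y_def clamp_at_def)
  have "(\<Sum>x\<in>S. p x * exp (l * Y x)) \<le> (\<Sum>x\<in>S. p x * (1 + l * (X x + (X x)\<^sup>2 / L) + l\<^sup>2 * (X x)\<^sup>2))"
  proof (intro sum_mono mult_left_mono p)
    fix x
    have "exp (l * Y x) \<le> 1 + l * Y x + l\<^sup>2 * (Y x)\<^sup>2"
      using exp_le_quadratic[OF Yb[of x]] by (simp add: power_mult_distrib)
    also have "\<dots> \<le> 1 + l * (X x + (X x)\<^sup>2 / L) + l\<^sup>2 * (X x)\<^sup>2"
      using L clamp_at_le[of L "X x"] Y2[of x]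
      by (intro add_mono mult_left_mono) (auto simp: Y_def)
    finally show "exp (l * Y x) \<le> 1 + l * (X x + (X x)\<^sup>2 / L) + l\<^sup>2 * (X x)\<^sup>2" .
  qed
  also have "\<dots> = (\<Sum>x\<in>S. p x + l * (p x * X x) + (l / L + l\<^sup>2) * (p x * (X x)\<^sup>2))"
    by (intro sum.cong refl) (simp add: algebra_simps)
  also have "\<dots> = 1 + l * m + (l / L + l\<^sup>2) * (\<Sum>x\<in>S. p x * (X x)\<^sup>2)"
    by (simp add: sum.distrib sum_distrib_left[symmetric] p m)
  also have "\<dots> \<le> 1 + l * m + (l / L + l\<^sup>2) * v"
    using L m2 by (intro add_left_mono mult_left_mono) auto
  also have "\<dots> \<le> exp (l * m + (l / L + l\<^sup>2) * v)"
    using exp_ge_add_one_self[of "l * m + (l / L + l\<^sup>2) * v"] by (simp only: add.assoc)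
  finally have mgf: "(\<Sum>x\<in>S. p x * exp (l * Y x)) \<le> exp (l * m + (l / L + l\<^sup>2) * v)" .
  have expo: "prod_list (map p xs) * exp (l * clamped_sum L X xs)
      = prod_list (map (\<lambda>x. p x * exp (l * Y x)) xs)" for xs
    by (induction xs) (simp_all add: clamped_sum_def Y_def distrib_left exp_add)
  have "iid_prob S p n (\<lambda>xs. real n * (m + 3/2 * t) < clamped_sum L X xs)
     \<le> (\<Sum>xs\<in>tuples S n. prod_list (map p xs) *
            exp (l * clamped_sum L X xs - l * (real n * (m + 3/2 * t))))"
    unfolding iid_prob_def
  proof (intro sum_mono mult_left_mono)
    fix xs assume xs: "xs \<in> tuples S n"
    show "0 \<le> prod_list (map p xs)" using p(1) xs by (rule prod_list_map_nonneg)
    show "of_bool (real n * (m + 3/2 * t) < clamped_sum L X xs)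
         \<le> exp (l * clamped_sum L X xs - l * (real n * (m + 3/2 * t)))"
      using L by (auto simp: right_diff_distrib[symmetric])
  qed
  also have "\<dots> = exp (- (l * (real n * (m + 3/2 * t))))
       * (\<Sum>xs\<in>tuples S n. prod_list (map (\<lambda>x. p x * exp (l * Y x)) xs))"
    unfolding expo[symmetric] sum_distrib_left
    by (intro sum.cong refl) (simp only: diff_conv_add_uminus exp_add mult_ac)
  also have "\<dots> \<le> exp (- (l * (real n * (m + 3/2 * t)))) * exp (l * m + (l / L + l\<^sup>2) * v) ^ n"
    unfolding sum_tuples_prod_list using mgf p(1)
    by (intro mult_left_mono power_mono sum_nonneg) auto
  also have "\<dots> = exp (real n * (l * m + (l / L + l\<^sup>2) * v - l * (m + 3/2 * t)))"
    by (simp add: exp_of_nat_mult[symmetric] exp_add[symmetric] algebra_simps)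
  also have "l * m + (l / L + l\<^sup>2) * v - l * (m + 3/2 * t) = - t\<^sup>2 / (4 * v)"
    using pos by (simp add: l_def L_def field_simps power2_eq_square)
  finally show ?thesis by (simp add: L_def)
qed

text \<open>Clamping is odd, so the lower tail is the upper tail of the negated variable.\<close>

lemma clamped_sum_tail:
  fixes p X :: "'a \<Rightarrow> real"
  assumes p: "\<And>x. x \<in> S \<Longrightarrow> 0 \<le> p x" "sum p S = 1"
    and m2: "(\<Sum>x\<in>S. p x * (X x)\<^sup>2) \<le> v" and pos: "0 < v" "0 < t"
    and m: "(\<Sum>x\<in>S. p x * X x) = m"
  shows "iid_prob S p n (\<lambda>xs. real n * (3/2 * t) < \<bar>clamped_sum (2 * v / t) X xs - real n * m\<bar>)
         \<le> 2 * exp (- real n * t\<^sup>2 / (4 * v))"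
proof -
  have neg: "clamped_sum L (\<lambda>x. - X x) xs = - clamped_sum L X xs" if "0 < L" for L xs
    using that by (induction xs) (auto simp: clamped_sum_def clamp_at_def max_def min_def)
  have "iid_prob S p n (\<lambda>xs. real n * (3/2 * t) < \<bar>clamped_sum (2 * v / t) X xs - real n * m\<bar>)
    \<le> iid_prob S p n (\<lambda>xs. real n * (m + 3/2 * t) < clamped_sum (2 * v / t) X xs
        \<or> real n * (- m + 3/2 * t) < clamped_sum (2 * v / t) (\<lambda>x. - X x) xs)"
    using pos by (intro iid_prob_mono p) (auto simp: neg algebra_simps abs_if split: if_splits)
  also have "\<dots> \<le> exp (- real n * t\<^sup>2 / (4 * v)) + exp (- real n * t\<^sup>2 / (4 * v))"
    using assms
    by (intro order.trans[OF iid_prob_disj] add_mono clamped_sum_upper_tail)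
       (auto simp: sum_negf)
  finally show ?thesis by simp
qed

section \<open>The prepare-and-measure statistics\<close>

definition sq :: "nat \<Rightarrow> (nat \<Rightarrow> complex) \<Rightarrow> real" where
  "sq d x = (\<Sum>i<d. (cmod (x i))\<^sup>2)"

lemma sq_nonneg [simp]: "0 \<le> sq d x"
  by (simp add: sq_def sum_nonneg)

lemma ip_self: "ip d x x = of_real (sq d x)"
  unfolding ip_def sq_def of_real_sum complex_norm_square by (simp only: mult.commute)

lemma sq_scale: "sq d (\<lambda>i. c * x i) = (cmod c)\<^sup>2 * sq d x"
  by (simp add: sq_def norm_mult power_mult_distrib sum_distrib_left)

lemma ip_scale_right: "ip d x (\<lambda>i. c * y i) = c * ip d x y"
  by (simp add: ip_def sum_distrib_left algebra_simps)

lemma sq_mv_unitary: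
  assumes "unitary_fun d Z" shows "sq d (mv d Z b) = sq d b"
proof -
  have "ip d (mv d Z b) (mv d Z b) = (\<Sum>i<d. \<Sum>j<d. if j = i then cnj (b i) * b j else 0)"
    unfolding ip_mv_mv using assms by (intro sum.cong refl) (simp add: unitary_fun_def)
  also have "\<dots> = ip d b b" by (simp add: ip_def)
  finally show ?thesis by (simp only: ip_self of_real_eq_iff)
qed

lemma cmod_letter_sq_le: "(cmod (letter k))\<^sup>2 \<le> 2"
  by (auto simp: letter_def norm_mult norm_power power_mult_distrib)

lemma sq_wvec_le: "sq d (wvec a) \<le> 2 * real d"
proof -
  have "sq d (wvec a) \<le> (\<Sum>i<d. 2)"
    unfolding sq_def wvec_def by (intro sum_mono cmod_letter_sq_le)
  then show ?thesis by simp
qed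

section \<open>Exponential and sixth moments of overlaps with random words\<close>

lemma exp_plus_exp_minus_le: "exp s + exp (- s) \<le> 2 * exp (s\<^sup>2)" for s :: real
proof (cases "\<bar>s\<bar> \<le> 1")
  case True
  have "exp s + exp (- s) \<le> 2 * (1 + s\<^sup>2)"
    using exp_le_quadratic[of s] exp_le_quadratic[of "-s"] True by simp
  also have "\<dots> \<le> 2 * exp (s\<^sup>2)" using exp_ge_add_one_self[of "s\<^sup>2"] by (intro mult_left_mono) auto
  finally show ?thesis .
next
  case False
  have "\<bar>s\<bar> * 1 \<le> \<bar>s\<bar> * \<bar>s\<bar>" using False by (intro mult_left_mono) auto
  then have "\<bar>s\<bar> \<le> s\<^sup>2" by (simp add: power2_eq_square)
  then have "exp s \<le> exp (s\<^sup>2)" "exp (- s) \<le> exp (s\<^sup>2)" by auto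
  from add_mono[OF this] show ?thesis by (simp only: mult_2)
qed

text \<open>Four letters are zero and the others give plus and minus \<open>x\<close> and plus and
  minus \<open>y\<close>; the symmetric pairs fall under
  \<open>exp_plus_exp_minus_le\<close>.\<close>

lemma letter_mgf_le: "(\<Sum>k<8. exp (Re (cnj (letter k) * z))) / 8 \<le> exp (2 * (cmod z)\<^sup>2)"
proof -
  define x y where "x = sqrt 2 * Re z" and "y = sqrt 2 * Im z"
  have e: "{..<8::nat} = {0,1,2,3,4,5,6,7}" by auto
  have xy: "x\<^sup>2 \<le> 2 * (cmod z)\<^sup>2" "y\<^sup>2 \<le> 2 * (cmod z)\<^sup>2"
    by (auto simp: x_def y_def power_mult_distrib cmod_power2)
  have "(\<Sum>k<8. exp (Re (cnj (letter k) * z))) = 4 + (exp x + exp (- x)) + (exp y + exp (- y))"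
    by (simp add: e letter_def power3_eq_cube x_def y_def)
  also have "\<dots> \<le> 4 + 2 * exp (2 * (cmod z)\<^sup>2) + 2 * exp (2 * (cmod z)\<^sup>2)"
    using exp_plus_exp_minus_le[of x] exp_plus_exp_minus_le[of y] xy
    by (intro add_mono order.refl; meson order.trans exp_le_cancel_iff mult_left_mono zero_le_numeral)
  also have "\<dots> \<le> 8 * exp (2 * (cmod z)\<^sup>2)" by simp
  finally show ?thesis by simp
qed

lemma wavg_exp_le: "wavg d (\<lambda>a. exp (Re (ip d a w))) \<le> exp (2 * sq d w)"
proof -
  have "wavg d (\<lambda>a. exp (Re (ip d a w))) = wavg d (\<lambda>a. \<Prod>j<d. exp (Re (cnj (a j) * w j)))"
    by (simp only: ip_def Re_sum exp_sum finite_lessThan)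
  also have "\<dots> = (\<Prod>j<d. (\<Sum>k<8. exp (Re (cnj (letter k) * w j))) / 8)"
    by (rule wavg_prod[of d "\<lambda>j x. exp (Re (cnj x * w j))"])
  also have "\<dots> \<le> (\<Prod>j<d. exp (2 * (cmod (w j))\<^sup>2))"
    using letter_mgf_le by (intro prod_mono) (auto intro!: sum_nonneg divide_nonneg_nonneg)
  also have "\<dots> = exp (2 * sq d w)"
    by (simp add: sq_def exp_sum sum_distrib_left)
  finally show ?thesis .
qed

lemma power6_le_exp: "x ^ 6 \<le> 6 ^ 6 * (exp x + exp (- x))" for x :: real
proof -
  have "\<bar>x\<bar> / 6 \<le> exp (\<bar>x\<bar> / 6)" using exp_ge_add_one_self[of "\<bar>x\<bar> / 6"] by linarith
  then have "(\<bar>x\<bar> / 6) ^ 6 \<le> exp (\<bar>x\<bar> / 6) ^ 6" by (intro power_mono) auto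
  also have "\<dots> = exp \<bar>x\<bar>" by (simp add: exp_of_nat_mult[symmetric])
  also have "\<dots> \<le> exp x + exp (- x)" by (auto simp: abs_if)
  finally have "\<bar>x\<bar> ^ 6 \<le> 6 ^ 6 * (exp x + exp (- x))" by (simp add: power_divide)
  then show ?thesis by (simp add: power_even_abs)
qed

lemma wavg_Re_ip6_le:
  assumes "sq d w \<le> 1"
  shows "wavg d (\<lambda>a. (Re (ip d a w)) ^ 6) \<le> 2 * 6 ^ 6 * exp 2"
proof -
  have "wavg d (\<lambda>a. (Re (ip d a w)) ^ 6)
      \<le> wavg d (\<lambda>a. 6 ^ 6 * (exp (Re (ip d a w)) + exp (Re (ip d a (\<lambda>i. (-1) * w i)))))"
    unfolding ip_scale_right by (rule wavg_mono) (simp only: mult_minus1 uminus_complex.sel, rule power6_le_exp)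
  also have "\<dots> \<le> 6 ^ 6 * (exp (2 * sq d w) + exp (2 * sq d (\<lambda>i. (-1) * w i)))"
    unfolding wavg_cmult wavg_add by (intro mult_left_mono add_mono wavg_exp_le) auto
  also have "\<dots> \<le> 6 ^ 6 * (exp 2 + exp 2)"
    using assms by (intro mult_left_mono add_mono) (auto simp: sq_def)
  finally show ?thesis by simp
qed

lemma wavg_ip6_le:
  assumes "sq d w \<le> 1"
  shows "wavg d (\<lambda>a. (cmod (ip d a w)) ^ 6) \<le> 16 * 6 ^ 6 * exp 2"
proof -
  have cub: "(s + t) ^ 3 \<le> 4 * (s ^ 3 + t ^ 3)" if "0 \<le> s" "0 \<le> t" for s t :: real
  proof -
    have "4 * (s ^ 3 + t ^ 3) - (s + t) ^ 3 = 3 * (s + t) * (s - t)\<^sup>2"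
      by (simp add: power2_eq_square power3_eq_cube algebra_simps)
    moreover have "0 \<le> 3 * (s + t) * (s - t)\<^sup>2" using that by simp
    ultimately show ?thesis by linarith
  qed
  \<comment> \<open>The imaginary part is, up to sign, the real part after multiplication by
    \<open>\<i>\<close>. Both terms are then covered by \<open>wavg_Re_ip6_le\<close>, the second
    with the vector rotated.\<close>
  have pw: "(cmod z) ^ 6 \<le> 4 * ((Re z) ^ 6 + (Re (\<i> * z)) ^ 6)" for z
  proof -
    have "(cmod z) ^ 6 = ((Re z)\<^sup>2 + (Im z)\<^sup>2) ^ 3"
      by (simp add: cmod_power2[symmetric] power_mult[symmetric])
    also have "\<dots> \<le> 4 * (((Re z)\<^sup>2) ^ 3 + ((Im z)\<^sup>2) ^ 3)" by (rule cub) auto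
    finally show ?thesis by (simp add: power_mult[symmetric])
  qed
  have "wavg d (\<lambda>a. (cmod (ip d a w)) ^ 6)
     \<le> wavg d (\<lambda>a. 4 * ((Re (ip d a w)) ^ 6 + (Re (ip d a (\<lambda>i. \<i> * w i))) ^ 6))"
    unfolding ip_scale_right by (rule wavg_mono) (rule pw)
  also have "\<dots> \<le> 4 * (2 * 6 ^ 6 * exp 2 + 2 * 6 ^ 6 * exp 2)"
    unfolding wavg_cmult wavg_add using assms
    by (intro mult_left_mono add_mono wavg_Re_ip6_le) (auto simp: sq_scale)
  finally show ?thesis by simp
qed

text \<open>Three times the sixth-moment bound of \<open>wavg_ip6_le\<close>: a product of three
  squared overlaps is at most the sum of their sixth powers. The constant is independent of the
  dimension.\<close>

definition C6 :: real where "C6 = 48 * 6 ^ 6 * exp 2"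

lemma C6_pos [simp]: "0 < C6" by (simp add: C6_def)

lemma wavg_triple_le_unit:
  assumes "sq d x \<le> 1" "sq d y \<le> 1" "sq d z \<le> 1"
  shows "wavg d (\<lambda>a. (cmod (ip d a x))\<^sup>2 * (cmod (ip d a y))\<^sup>2 * (cmod (ip d a z))\<^sup>2) \<le> C6"
proof -
  have amgm: "p * q * r \<le> p ^ 3 + q ^ 3 + r ^ 3" if "0 \<le> p" "0 \<le> q" "0 \<le> r" for p q r :: real
  proof -
    define m where "m = max p (max q r)"
    have m: "p \<le> m" "q \<le> m" "r \<le> m" by (auto simp: m_def)
    have "p * q * r \<le> m * m * m" using m that by (intro mult_mono) auto
    moreover have "m = p \<or> m = q \<or> m = r" by (auto simp: m_def max_def)
    moreover have "0 \<le> p ^ 3" "0 \<le> q ^ 3" "0 \<le> r ^ 3" using that by auto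
    ultimately show ?thesis by (auto simp: power3_eq_cube)
  qed
  have "wavg d (\<lambda>a. (cmod (ip d a x))\<^sup>2 * (cmod (ip d a y))\<^sup>2 * (cmod (ip d a z))\<^sup>2)
    \<le> wavg d (\<lambda>a. (cmod (ip d a x)) ^ 6 + (cmod (ip d a y)) ^ 6 + (cmod (ip d a z)) ^ 6)"
  proof (rule wavg_mono)
    fix a
    show "(cmod (ip d (wvec a) x))\<^sup>2 * (cmod (ip d (wvec a) y))\<^sup>2 * (cmod (ip d (wvec a) z))\<^sup>2
      \<le> (cmod (ip d (wvec a) x)) ^ 6 + (cmod (ip d (wvec a) y)) ^ 6 + (cmod (ip d (wvec a) z)) ^ 6"
      using amgm[of "(cmod (ip d (wvec a) x))\<^sup>2" "(cmod (ip d (wvec a) y))\<^sup>2" "(cmod (ip d (wvec a) z))\<^sup>2"]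
      by (simp add: power_mult[symmetric])
  qed
  also have "\<dots> \<le> 16 * 6 ^ 6 * exp 2 + 16 * 6 ^ 6 * exp 2 + 16 * 6 ^ 6 * exp 2"
    unfolding wavg_add using assms by (intro add_mono wavg_ip6_le)
  finally show ?thesis by (simp add: C6_def)
qed

text \<open>The average is homogeneous in each vector, so everything rescales to the unit
  case.\<close>

lemma wavg_triple_le:
  assumes "sq d x \<le> \<alpha>" "sq d y \<le> \<beta>" "sq d z \<le> \<gamma>" and pos: "0 < \<alpha>" "0 < \<beta>" "0 < \<gamma>"
  shows "wavg d (\<lambda>a. (cmod (ip d a x))\<^sup>2 * (cmod (ip d a y))\<^sup>2 * (cmod (ip d a z))\<^sup>2) \<le> \<alpha> * \<beta> * \<gamma> * C6"
proof -
  define c where "c t = complex_of_real (1 / sqrt t)" for t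
  have c: "(cmod (c t))\<^sup>2 = 1 / t" if "0 < t" for t
    using that by (simp add: c_def norm_divide power_divide)
  have unit: "sq d (\<lambda>i. c t * w i) \<le> 1" if "0 < t" "sq d w \<le> t" for t w
    using that by (simp add: sq_scale c field_simps)
  have s: "(cmod (ip d a w))\<^sup>2 = t * (cmod (ip d a (\<lambda>i. c t * w i)))\<^sup>2" if "0 < t" for t w a
    using that by (simp add: ip_scale_right norm_mult power_mult_distrib c)
  have "wavg d (\<lambda>a. (cmod (ip d a x))\<^sup>2 * (cmod (ip d a y))\<^sup>2 * (cmod (ip d a z))\<^sup>2)
     = wavg d (\<lambda>a. (\<alpha> * \<beta> * \<gamma>) * ((cmod (ip d a (\<lambda>i. c \<alpha> * x i)))\<^sup>2 *
          (cmod (ip d a (\<lambda>i. c \<beta> * y i)))\<^sup>2 * (cmod (ip d a (\<lambda>i. c \<gamma> * z i)))\<^sup>2))"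
    by (simp add: s[OF pos(1), of _ x] s[OF pos(2), of _ y] s[OF pos(3), of _ z] mult_ac)
  also have "\<dots> \<le> (\<alpha> * \<beta> * \<gamma>) * C6"
    unfolding wavg_cmult using pos assms(1-3)
    by (intro mult_left_mono wavg_triple_le_unit unit) auto
  finally show ?thesis .
qed

section \<open>The law of one sample and the two statistics\<close>

definition sample_space :: "nat \<Rightarrow> ((nat \<Rightarrow> nat) \<times> (nat \<Rightarrow> nat)) set" where
  "sample_space d = words d \<times> words d"

text \<open>Uniform weight on pairs of words, 64 = 8 * 8 per coordinate, times a density; dividing
  by \<open>d\<close> normalises because the squared overlap has mean \<open>d\<close>.\<close>

definition sample_prob :: "nat \<Rightarrow> (nat \<Rightarrow> nat \<Rightarrow> complex) \<Rightarrow> (nat \<Rightarrow> nat) \<times> (nat \<Rightarrow> nat) \<Rightarrow> real" where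
  "sample_prob d Z = (\<lambda>(b, a). (cmod (ip d (wvec a) (mv d Z (wvec b))))\<^sup>2 / (real d * 64 ^ d))"

lemma sample_prob_nonneg: "0 \<le> sample_prob d Z \<omega>"
  by (simp add: sample_prob_def case_prod_unfold)

lemma sum_sample_prob:
  "(\<Sum>\<omega>\<in>sample_space d. sample_prob d Z \<omega> * (case \<omega> of (b, a) \<Rightarrow> g (wvec b) (wvec a)))
    = wavg d (\<lambda>b. wavg d (\<lambda>a. (cmod (ip d a (mv d Z b)))\<^sup>2 * g b a)) / real d"
proof -
  have 64: "(64::real) ^ d = 8 ^ d * 8 ^ d" by (simp add: power_mult_distrib[symmetric])
  show ?thesis
    unfolding sample_space_def sum.cartesian_product[symmetric] wavg_def sample_prob_def
    by (simp add: sum.cartesian_product[symmetric] sum_divide_distrib sum_distrib_right 64 field_simps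
        sum.cartesian_product' case_prod_unfold)
qed

lemma wavg_estimator_mean_real:
  assumes Z: "unitary_fun d Z"
  shows "wavg d (\<lambda>b. wavg d (\<lambda>a. (cmod (ip d a (mv d Z b)))\<^sup>2 *
            Re (ip d a (mv d R b) * cnj (ip d a (mv d W b)))))
    = Re (hs d W Z * hs d Z R + (of_nat d + 2) * hs d W R)"
proof -
  have R: "Re (wavg d f) = wavg d (\<lambda>a. Re (f a))" for f
  proof -
    have "(8::complex) ^ d = of_real (8 ^ d)" by simp
    then show ?thesis unfolding wavg_def by (simp only: Re_divide_of_real Re_sum)
  qed
  show ?thesis
    unfolding wavg_estimator_mean[OF Z, symmetric] R complex_norm_square[symmetric]
    by simp
qed

lemma wavg_sq: "wavg d (sq d) = real d"
proof -
  have "complex_of_real (wavg d (sq d)) = of_nat d"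
    unfolding wavg_of_real[symmetric] ip_self[symmetric] ip_def wavg_sum
    by (simp add: wavg_quadratic_monomial)
  then show ?thesis by (metis of_real_eq_iff of_real_of_nat_eq)
qed

text \<open>Averaging over the measured word gives the squared norm of \<open>mv d Z b\<close>,
  which unitarity reduces to that of \<open>b\<close>, of mean \<open>d\<close>.\<close>

lemma sum_sample_prob_1:
  assumes "unitary_fun d Z" "0 < d"
  shows "sum (sample_prob d Z) (sample_space d) = 1"
proof -
  have "complex_of_real (wavg d (\<lambda>a. (cmod (ip d a w))\<^sup>2)) = of_real (sq d w)" for w
    unfolding wavg_of_real[symmetric] complex_norm_square wavg_ip2 ip_self ..
  then have n: "wavg d (\<lambda>a. (cmod (ip d a w))\<^sup>2) = sq d w" for w
    by (simp only: of_real_eq_iff)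
  show ?thesis
    using sum_sample_prob[of d Z "\<lambda>_ _. 1"] assms by (simp add: n sq_mv_unitary wavg_sq case_prod_unfold)
qed

text \<open>The estimator with \<open>W = R\<close>, scaled so that its mean is the normalised
  squared overlap of \<open>Z\<close> with \<open>W\<close> plus an offset known in advance.\<close>

definition overlap_stat :: "nat \<Rightarrow> (nat \<Rightarrow> nat \<Rightarrow> complex) \<Rightarrow> (nat \<Rightarrow> nat) \<times> (nat \<Rightarrow> nat) \<Rightarrow> real" where
  "overlap_stat d W = (\<lambda>(b, a). (cmod (ip d (wvec a) (mv d W (wvec b))))\<^sup>2 / real d)"

text \<open>The factor under the conjugate is \<open>ip d a (mv d W b)\<close> for the rank-one
  \<open>W\<close> with entries \<open>u i * cnj (v j)\<close>. Real parts suffice because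
  \<open>u\<close> will range over a net of all complex unit vectors, phases included.\<close>

definition entry_stat :: "nat \<Rightarrow> (nat \<Rightarrow> nat \<Rightarrow> complex) \<Rightarrow> (nat \<Rightarrow> complex) \<Rightarrow> (nat \<Rightarrow> complex)
    \<Rightarrow> (nat \<Rightarrow> nat) \<times> (nat \<Rightarrow> nat) \<Rightarrow> real" where
  "entry_stat d R u v = (\<lambda>(b, a). Re (ip d (wvec a) (mv d R (wvec b)) *
       cnj (ip d v (wvec b) * ip d (wvec a) u)))"

lemma hs_self: "unitary_fun d Z \<Longrightarrow> hs d Z Z = of_nat d"
  by (simp add: hs_def unitary_fun_def)

lemma hs_cnj: "hs d A B = cnj (hs d B A)"
  by (simp add: hs_def mult.commute)

lemma overlap_stat_mean:
  assumes "unitary_fun d Z" "unitary_fun d W" "0 < d"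
  shows "(\<Sum>\<omega>\<in>sample_space d. sample_prob d Z \<omega> * overlap_stat d W \<omega>)
     = (cmod (hs d Z W))\<^sup>2 / (real d)\<^sup>2 + 1 + 2 / real d"
proof -
  have "(\<Sum>\<omega>\<in>sample_space d. sample_prob d Z \<omega> * overlap_stat d W \<omega>) =
      wavg d (\<lambda>b. wavg d (\<lambda>a. (cmod (ip d a (mv d Z b)))\<^sup>2 * ((cmod (ip d a (mv d W b)))\<^sup>2 / real d))) / real d"
    unfolding overlap_stat_def by (rule sum_sample_prob)
  also have "\<dots> = wavg d (\<lambda>b. wavg d (\<lambda>a. (1 / real d) * ((cmod (ip d a (mv d Z b)))\<^sup>2 *
       Re (ip d a (mv d W b) * cnj (ip d a (mv d W b)))))) / real d"
    by (simp add: complex_norm_square[symmetric] del: times_complex.sel)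
  also have "\<dots> = Re (hs d W Z * hs d Z W + (of_nat d + 2) * hs d W W) / (real d)\<^sup>2"
    unfolding wavg_cmult wavg_estimator_mean_real[OF assms(1)] by (simp add: power2_eq_square)
  also have "hs d W Z * hs d Z W + (of_nat d + 2) * hs d W W
       = of_real ((cmod (hs d Z W))\<^sup>2 + (real d + 2) * real d)"
    unfolding hs_self[OF assms(2)] hs_cnj[of d W Z] of_real_add complex_norm_square
    by (simp add: mult.commute)
  finally show ?thesis using assms(3)
    by (simp only: Re_complex_of_real) (simp add: field_simps power2_eq_square)
qed

text \<open>All three overlaps involve vectors of squared norm at most \<open>2 * real d\<close>,
  and the resulting cube of \<open>d\<close> is cancelled by the scaling.\<close>

lemma overlap_stat_second_moment:
  assumes "unitary_fun d Z" "unitary_fun d W" "0 < d"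
  shows "(\<Sum>\<omega>\<in>sample_space d. sample_prob d Z \<omega> * (overlap_stat d W \<omega>)\<^sup>2) \<le> 8 * C6"
proof -
  have "(\<Sum>\<omega>\<in>sample_space d. sample_prob d Z \<omega> * (overlap_stat d W \<omega>)\<^sup>2) =
     (\<Sum>\<omega>\<in>sample_space d. sample_prob d Z \<omega> * (case \<omega> of (b, a) \<Rightarrow>
        (\<lambda>b a. ((cmod (ip d a (mv d W b)))\<^sup>2 / real d)\<^sup>2) (wvec b) (wvec a)))"
    by (simp add: overlap_stat_def case_prod_unfold)
  also have "\<dots> = wavg d (\<lambda>b. wavg d (\<lambda>a. (cmod (ip d a (mv d Z b)))\<^sup>2 * ((cmod (ip d a (mv d W b)))\<^sup>2 / real d)\<^sup>2)) / real d"
    by (rule sum_sample_prob)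
  also have "\<dots> = wavg d (\<lambda>b. wavg d (\<lambda>a. (1 / (real d)\<^sup>2) * ((cmod (ip d a (mv d Z b)))\<^sup>2 *
       (cmod (ip d a (mv d W b)))\<^sup>2 * (cmod (ip d a (mv d W b)))\<^sup>2))) / real d"
    by (simp add: power2_eq_square mult_ac)
  also have "\<dots> = wavg d (\<lambda>b. wavg d (\<lambda>a. (cmod (ip d a (mv d Z b)))\<^sup>2 *
       (cmod (ip d a (mv d W b)))\<^sup>2 * (cmod (ip d a (mv d W b)))\<^sup>2)) / (real d) ^ 3"
    unfolding wavg_cmult by (simp add: power2_eq_square power3_eq_cube)
  also have "\<dots> \<le> wavg d (\<lambda>b. (2 * real d) * (2 * real d) * (2 * real d) * C6) / (real d) ^ 3"
    using assms by (intro divide_right_mono wavg_mono wavg_triple_le) (auto simp: sq_mv_unitary sq_wvec_le)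
  also have "\<dots> = 8 * C6" using assms(3) by (simp add: power3_eq_cube)
  finally show ?thesis .
qed

lemma mv_rank_one: "mv d (\<lambda>i j. u i * cnj (v j)) b = (\<lambda>i. ip d v b * u i)"
  by (rule ext) (simp add: mv_def ip_def sum_distrib_left sum_distrib_right mult_ac)

lemma hs_rank_one: "hs d (\<lambda>i j. u i * cnj (v j)) M = ip d u (mv d M v)"
proof -
  have "hs d (\<lambda>i j. u i * cnj (v j)) M = (\<Sum>m<d. \<Sum>i<d. cnj (u m * cnj (v i)) * M m i)"
    unfolding hs_def by (rule sum.swap)
  then show ?thesis by (simp add: ip_def mv_def sum_distrib_left mult_ac)
qed

lemma entry_stat_mean:
  assumes "unitary_fun d Z" "0 < d"
  shows "(\<Sum>\<omega>\<in>sample_space d. sample_prob d Z \<omega> * entry_stat d R u v \<omega>)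
     = Re (hs d Z R / of_nat d * ip d u (mv d Z v)) + (1 + 2 / real d) * Re (ip d u (mv d R v))"
proof -
  have "(\<Sum>\<omega>\<in>sample_space d. sample_prob d Z \<omega> * entry_stat d R u v \<omega>) =
      wavg d (\<lambda>b. wavg d (\<lambda>a. (cmod (ip d a (mv d Z b)))\<^sup>2 *
         Re (ip d a (mv d R b) * cnj (ip d v b * ip d a u)))) / real d"
    unfolding entry_stat_def by (rule sum_sample_prob)
  also have "\<dots> = wavg d (\<lambda>b. wavg d (\<lambda>a. (cmod (ip d a (mv d Z b)))\<^sup>2 *
         Re (ip d a (mv d R b) * cnj (ip d a (mv d (\<lambda>i j. u i * cnj (v j)) b))))) / real d"
    unfolding mv_rank_one ip_scale_right ..
  also have "\<dots> = Re (ip d u (mv d Z v) * hs d Z R + of_real (real d + 2) * ip d u (mv d R v)) / real d"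
    unfolding wavg_estimator_mean_real[OF assms(1)] hs_rank_one by simp
  also have "\<dots> = Re ((ip d u (mv d Z v) * hs d Z R + of_real (real d + 2) * ip d u (mv d R v)) / of_real (real d))"
    by (simp only: Re_divide_of_real)
  also have "(ip d u (mv d Z v) * hs d Z R + of_real (real d + 2) * ip d u (mv d R v)) / of_real (real d)
     = hs d Z R / of_nat d * ip d u (mv d Z v) + of_real (1 + 2 / real d) * ip d u (mv d R v)"
    using assms(2) by (simp add: field_simps)
  finally show ?thesis
    by (simp only: plus_complex.sel Re_complex_of_real Im_complex_of_real times_complex.sel mult_zero_left diff_zero)
qed

text \<open>The factor from \<open>v\<close> depends on \<open>b\<close> only and is kept in the
  outer average, where its mean is 1; bounding it pointwise would cost another factor
  \<open>d\<close>. The inner triple moment has two vectors of squared norm at most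
  \<open>2 * real d\<close> and the unit vector \<open>u\<close>.\<close>

lemma entry_stat_second_moment:
  assumes "unitary_fun d Z" "unitary_fun d R" "0 < d" "sq d u = 1" "sq d v = 1"
  shows "(\<Sum>\<omega>\<in>sample_space d. sample_prob d Z \<omega> * (entry_stat d R u v \<omega>)\<^sup>2) \<le> 4 * C6 * real d"
proof -
  have n: "wavg d (\<lambda>b. (cmod (ip d b v))\<^sup>2) = 1"
  proof -
    have "complex_of_real (wavg d (\<lambda>a. (cmod (ip d a v))\<^sup>2)) = of_real (sq d v)"
      unfolding wavg_of_real[symmetric] complex_norm_square wavg_ip2 ip_self ..
    then show ?thesis using assms(5) by (simp only: of_real_eq_iff)
  qed
  have cm: "cmod (ip d v b) = cmod (ip d b v)" for b
  proof -
    have "ip d v b = cnj (ip d b v)" by (simp add: ip_def mult.commute)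
    then show ?thesis by simp
  qed
  have "(\<Sum>\<omega>\<in>sample_space d. sample_prob d Z \<omega> * (entry_stat d R u v \<omega>)\<^sup>2) =
     (\<Sum>\<omega>\<in>sample_space d. sample_prob d Z \<omega> * (case \<omega> of (b, a) \<Rightarrow>
        (\<lambda>b a. (Re (ip d a (mv d R b) * cnj (ip d v b * ip d a u)))\<^sup>2) (wvec b) (wvec a)))"
    by (simp add: entry_stat_def case_prod_unfold)
  also have "\<dots> = wavg d (\<lambda>b. wavg d (\<lambda>a. (cmod (ip d a (mv d Z b)))\<^sup>2 *
       (Re (ip d a (mv d R b) * cnj (ip d v b * ip d a u)))\<^sup>2)) / real d"
    by (rule sum_sample_prob)
  also have "\<dots> \<le> wavg d (\<lambda>b. wavg d (\<lambda>a. (cmod (ip d b v))\<^sup>2 * ((cmod (ip d a (mv d Z b)))\<^sup>2 *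
       (cmod (ip d a (mv d R b)))\<^sup>2 * (cmod (ip d a u))\<^sup>2))) / real d"
  proof (intro divide_right_mono wavg_mono)
    fix a b
    define z where "z = ip d (wvec a) (mv d R (wvec b)) * cnj (ip d v (wvec b) * ip d (wvec a) u)"
    have "(Re z)\<^sup>2 \<le> (cmod z)\<^sup>2" by (simp add: cmod_power2)
    also have "\<dots> = (cmod (ip d (wvec b) v))\<^sup>2 * ((cmod (ip d (wvec a) (mv d R (wvec b))))\<^sup>2 * (cmod (ip d (wvec a) u))\<^sup>2)"
      by (simp add: z_def norm_mult power_mult_distrib cm)
    finally have "(cmod (ip d (wvec a) (mv d Z (wvec b))))\<^sup>2 * (Re z)\<^sup>2 \<le>
        (cmod (ip d (wvec a) (mv d Z (wvec b))))\<^sup>2 * \<dots>"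
      by (intro mult_left_mono) auto
    then show "(cmod (ip d (wvec a) (mv d Z (wvec b))))\<^sup>2 *
       (Re (ip d (wvec a) (mv d R (wvec b)) * cnj (ip d v (wvec b) * ip d (wvec a) u)))\<^sup>2
      \<le> (cmod (ip d (wvec b) v))\<^sup>2 * ((cmod (ip d (wvec a) (mv d Z (wvec b))))\<^sup>2 *
       (cmod (ip d (wvec a) (mv d R (wvec b))))\<^sup>2 * (cmod (ip d (wvec a) u))\<^sup>2)"
      unfolding z_def by (simp only: mult_ac)
  qed auto
  also have "\<dots> \<le> wavg d (\<lambda>b. (cmod (ip d b v))\<^sup>2 * ((2 * real d) * (2 * real d) * 1 * C6)) / real d"
    unfolding wavg_cmult using assms
    by (intro divide_right_mono wavg_mono mult_left_mono wavg_triple_le) (auto simp: sq_mv_unitary sq_wvec_le)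
  also have "\<dots> = 4 * C6 * real d"
    using assms(3) unfolding mult.commute[of "(cmod _)\<^sup>2"] wavg_cmult n by (simp add: power2_eq_square)
  finally show ?thesis .
qed

section \<open>Nets and operator norms\<close>

lemma sum_exp_neg_square_le: "(\<Sum>k\<in>{- int M..int M}. exp (- (real_of_int k)\<^sup>2)) \<le> 3"
proof -
  have half: "exp (- 1) \<le> (1/2 :: real)"
    using exp_ge_add_one_self[of 1] by (simp add: exp_minus field_simps)
  \<comment> \<open>The bound is strengthened so that induction closes: the two new terms add at
    most (1/2)^M, exactly the gain on the right.\<close>
  have "(\<Sum>k\<in>{- int M..int M}. exp (- (real_of_int k)\<^sup>2)) \<le> 3 - 2 * (1/2) ^ M"
  proof (induction M)
    case (Suc M)
    have e: "{- int (Suc M)..int (Suc M)} = insert (- int (Suc M)) (insert (int (Suc M)) {- int M..int M})"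
      by auto
    have "exp (- (real (Suc M))\<^sup>2) \<le> exp (- real (Suc M))"
      by (simp add: power2_eq_square algebra_simps)
    also have "\<dots> = exp (- 1) ^ Suc M" by (simp add: exp_of_nat_mult[symmetric] del: power_Suc)
    also have "\<dots> \<le> (1/2) ^ Suc M" using half by (intro power_mono) auto
    finally have "2 * exp (- (real (Suc M))\<^sup>2) \<le> (1/2) ^ M" by simp
    moreover have "(\<Sum>k\<in>{- int (Suc M)..int (Suc M)}. exp (- (real_of_int k)\<^sup>2))
       = 2 * exp (- (real (Suc M))\<^sup>2) + (\<Sum>k\<in>{- int M..int M}. exp (- (real_of_int k)\<^sup>2))"
      unfolding e by (simp add: power2_eq_square algebra_simps)
    ultimately show ?case using Suc by simp
  qed simp
  also have "\<dots> \<le> 3" by simp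
  finally show ?thesis .
qed

text \<open>Markov's inequality for the product weight \<open>exp (- m\<^sup>2)\<close> on integer vectors.\<close>
lemma card_short_integer_vectors:
  fixes A :: real
  assumes I: "finite I"
  defines "S \<equiv> {m \<in> PiE I (\<lambda>_. UNIV :: int set). (\<Sum>i\<in>I. (real_of_int (m i))\<^sup>2) \<le> A * card I}"
  shows "finite S" "real (card S) \<le> (3 * exp A) ^ card I"
proof -
  define N where "N = card I"
  define M where "M = nat \<lceil>A * N\<rceil>"
  define T where "T = PiE I (\<lambda>_. {- int M..int M})"
  have T: "finite T" unfolding T_def using I by (simp add: finite_PiE)
  have ST: "S \<subseteq> T"
  proof
    fix m assume m: "m \<in> S"
    have "m i \<in> {- int M..int M}" if i: "i \<in> I" for i
    proof -
      have "real_of_int \<bar>m i\<bar> \<le> (real_of_int (m i))\<^sup>2"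
      proof (cases "m i = 0")
        case False
        then have "1 \<le> real_of_int \<bar>m i\<bar>" by linarith
        then have "real_of_int \<bar>m i\<bar> * 1 \<le> real_of_int \<bar>m i\<bar> * real_of_int \<bar>m i\<bar>" by (intro mult_left_mono) auto
        then show ?thesis by (simp add: power2_eq_square)
      qed simp
      also have "\<dots> \<le> (\<Sum>i\<in>I. (real_of_int (m i))\<^sup>2)"
        using I i by (intro member_le_sum) auto
      also have "\<dots> \<le> A * N" using m by (simp add: S_def N_def)
      finally have "\<bar>m i\<bar> \<le> int M" unfolding M_def by linarith
      then show ?thesis by auto
    qed
    then show "m \<in> T" using m by (auto simp: T_def S_def PiE_iff)
  qed
  then show "finite S" using T finite_subset by blast
  have "real (card S) = (\<Sum>m\<in>S. 1)" by simp
  also have "\<dots> \<le> (\<Sum>m\<in>S. exp (A * N) * (\<Prod>i\<in>I. exp (- (real_of_int (m i))\<^sup>2)))"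
    by (rule sum_mono)
       (simp add: exp_sum[OF I, symmetric] exp_add[symmetric] S_def N_def sum_negf)
  also have "\<dots> \<le> (\<Sum>m\<in>T. exp (A * N) * (\<Prod>i\<in>I. exp (- (real_of_int (m i))\<^sup>2)))"
    using ST T by (intro sum_mono2) (auto intro!: mult_nonneg_nonneg prod_nonneg)
  also have "\<dots> = exp (A * N) * (\<Prod>i\<in>I. \<Sum>k\<in>{- int M..int M}. exp (- (real_of_int k)\<^sup>2))"
    unfolding T_def using I by (subst prod_sum_PiE) (auto simp: sum_distrib_left)
  also have "\<dots> \<le> exp (A * N) * (\<Prod>i\<in>I. 3)"
    using sum_exp_neg_square_le by (intro mult_left_mono prod_mono) (auto intro!: sum_nonneg)
  also have "\<dots> = (3 * exp A) ^ card I"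
    by (simp add: N_def power_mult_distrib exp_of_nat_mult[symmetric] mult.commute)
  finally show "real (card S) \<le> (3 * exp A) ^ card I" .
qed

text \<open>Round to a grid of side \<open>\<delta>\<close> and keep one point of \<open>S\<close>
  per occupied cell, so that the net lies inside \<open>S\<close>. The floor vectors have mean
  square at most 2 / \<delta>^2 + 2, hence are exponentially few in the dimension, with no
  logarithmic factor.\<close>

lemma real_net:
  fixes S :: "('i \<Rightarrow> real) set" and \<delta> :: real
  assumes I: "finite I" and S: "\<And>x. x \<in> S \<Longrightarrow> (\<Sum>i\<in>I. (x i)\<^sup>2) \<le> card I" and \<delta>: "0 < \<delta>"
  obtains T where "finite T" "T \<subseteq> S" "real (card T) \<le> (3 * exp (2 / \<delta>\<^sup>2 + 2)) ^ card I"
    "\<And>x. x \<in> S \<Longrightarrow> \<exists>y\<in>T. (\<Sum>i\<in>I. (x i - y i)\<^sup>2) \<le> \<delta>\<^sup>2 * card I"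
proof -
  define q where "q x = restrict (\<lambda>i. \<lfloor>x i / \<delta>\<rfloor>) I" for x :: "'i \<Rightarrow> real"
  define V where "V = {m \<in> PiE I (\<lambda>_. UNIV :: int set).
      (\<Sum>i\<in>I. (real_of_int (m i))\<^sup>2) \<le> (2 / \<delta>\<^sup>2 + 2) * card I}"
  note V = card_short_integer_vectors[OF I, of "2 / \<delta>\<^sup>2 + 2", folded V_def]
  have fl: "(real_of_int \<lfloor>y\<rfloor>)\<^sup>2 \<le> 2 * y\<^sup>2 + 2" for y :: real
  proof -
    have "\<bar>real_of_int \<lfloor>y\<rfloor>\<bar> \<le> \<bar>\<bar>y\<bar> + 1\<bar>" by linarith
    then have "(real_of_int \<lfloor>y\<rfloor>)\<^sup>2 \<le> (\<bar>y\<bar> + 1)\<^sup>2" by (simp only: abs_le_square_iff)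
    moreover have "0 \<le> (\<bar>y\<bar> - 1)\<^sup>2" by simp
    ultimately show ?thesis by (simp add: power2_eq_square algebra_simps)
  qed
  have qV: "q ` S \<subseteq> V"
  proof
    fix m assume "m \<in> q ` S"
    then obtain x where x: "x \<in> S" "m = q x" by auto
    have "(\<Sum>i\<in>I. (real_of_int (q x i))\<^sup>2) \<le> (\<Sum>i\<in>I. 2 * (x i / \<delta>)\<^sup>2 + 2)"
      by (rule sum_mono) (use fl in \<open>auto simp: q_def\<close>)
    also have "\<dots> = 2 / \<delta>\<^sup>2 * (\<Sum>i\<in>I. (x i)\<^sup>2) + 2 * card I"
      by (simp add: sum.distrib power_divide sum_distrib_left)
    also have "\<dots> \<le> 2 / \<delta>\<^sup>2 * card I + 2 * card I"
      using S[OF x(1)] by (intro add_right_mono mult_left_mono) auto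
    finally show "m \<in> V" using x by (auto simp: V_def q_def algebra_simps)
  qed
  define rep where "rep c = (SOME x. x \<in> S \<and> q x = c)" for c
  have rep: "rep c \<in> S \<and> q (rep c) = c" if "c \<in> q ` S" for c
  proof -
    have "\<exists>x. x \<in> S \<and> q x = c" using that by auto
    then show ?thesis unfolding rep_def by (rule someI_ex)
  qed
  show thesis
  proof
    show "finite (rep ` q ` S)" using qV V(1) finite_subset by blast
    show "rep ` q ` S \<subseteq> S" using rep by blast
    have "card (rep ` q ` S) \<le> card (q ` S)" using qV V(1) finite_subset card_image_le by blast
    also have "\<dots> \<le> card V" using qV V(1) by (rule card_mono[rotated])
    finally show "real (card (rep ` q ` S)) \<le> (3 * exp (2 / \<delta>\<^sup>2 + 2)) ^ card I" using V(2) by simp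
    fix x assume x: "x \<in> S"
    define y where "y = rep (q x)"
    have "q y = q x" using rep x by (auto simp: y_def)
    have "\<bar>x i - y i\<bar> \<le> \<bar>\<delta>\<bar>" if "i \<in> I" for i
    proof -
      have "\<lfloor>x i / \<delta>\<rfloor> = \<lfloor>y i / \<delta>\<rfloor>" using fun_cong[OF \<open>q y = q x\<close>, of i] that by (simp add: q_def)
      then have "\<bar>x i / \<delta> - y i / \<delta>\<bar> \<le> 1" by linarith
      then show ?thesis using \<delta> by (simp add: diff_divide_distrib[symmetric] abs_divide)
    qed
    then have "(\<Sum>i\<in>I. (x i - y i)\<^sup>2) \<le> (\<Sum>i\<in>I. \<delta>\<^sup>2)"
      by (intro sum_mono) (simp only: abs_le_square_iff[symmetric])
    then show "\<exists>y\<in>rep ` q ` S. (\<Sum>i\<in>I. (x i - y i)\<^sup>2) \<le> \<delta>\<^sup>2 * card I"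
      using x by (intro bexI[of _ y]) (auto simp: y_def mult.commute)
  qed
qed

text \<open>The base from \<open>real_net\<close> at grid side 1/4.\<close>

definition net_base :: real where "net_base = 3 * exp 34"

lemma complex_net:
  fixes S :: "('j \<Rightarrow> complex) set"
  assumes J: "finite J" "J \<noteq> {}" and B: "0 < B"
    and S: "\<And>f. f \<in> S \<Longrightarrow> (\<Sum>j\<in>J. (cmod (f j))\<^sup>2) \<le> B"
  obtains T where "finite T" "T \<subseteq> S" "real (card T) \<le> net_base ^ (2 * card J)"
    "\<And>f. f \<in> S \<Longrightarrow> \<exists>g\<in>T. (\<Sum>j\<in>J. (cmod (f j - g j))\<^sup>2) \<le> B / 16"
proof -
  define I where "I = J \<times> (UNIV :: bool set)"
  have I: "finite I" "card I = 2 * card J" using J by (auto simp: I_def card_cartesian_product)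
  \<comment> \<open>Real and imaginary parts become \<open>2 * card J\<close> coordinates; this
    scale turns the bound \<open>B\<close> into the norm bound \<open>card I\<close> that
    \<open>real_net\<close> expects.\<close>
  define s where "s = sqrt (card I / B)"
  have "card J > 0" using J by (simp add: card_gt_0_iff)
  then have s: "0 < s" "s\<^sup>2 = card I / B" using B I by (auto simp: s_def)
  define x where "x f = (\<lambda>(j, r). s * (if r then Re (f j) else Im (f j)))" for f :: "'j \<Rightarrow> complex"
  have sumI: "(\<Sum>i\<in>I. h i) = (\<Sum>j\<in>J. h (j, True) + h (j, False))" for h :: "_ \<Rightarrow> real"
    unfolding I_def by (simp add: sum.cartesian_product' UNIV_bool add.commute)
  have xs: "(\<Sum>i\<in>I. (x f i - x g i)\<^sup>2) = s\<^sup>2 * (\<Sum>j\<in>J. (cmod (f j - g j))\<^sup>2)" for f g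
    unfolding sumI by (simp add: x_def right_diff_distrib[symmetric] power_mult_distrib
        distrib_left[symmetric] sum_distrib_left[symmetric] cmod_power2)
  have x0: "x (\<lambda>_. 0) i = 0" for i by (simp add: x_def case_prod_unfold)
  obtain T where T: "finite T" "T \<subseteq> x ` S" "real (card T) \<le> (3 * exp (2 / (1/4)\<^sup>2 + 2)) ^ card I"
    "\<And>y. y \<in> x ` S \<Longrightarrow> \<exists>z\<in>T. (\<Sum>i\<in>I. (y i - z i)\<^sup>2) \<le> (1/4)\<^sup>2 * card I"
  proof (rule real_net[OF I(1), of "x ` S" "1/4"])
    fix y assume "y \<in> x ` S"
    then obtain f where f: "f \<in> S" "y = x f" by auto
    have "(\<Sum>i\<in>I. (y i)\<^sup>2) = s\<^sup>2 * (\<Sum>j\<in>J. (cmod (f j))\<^sup>2)"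
      using xs[of f "\<lambda>_. 0"] by (simp add: x0 f)
    also have "\<dots> \<le> s\<^sup>2 * B" using S[OF f(1)] by (intro mult_left_mono) auto
    finally show "(\<Sum>i\<in>I. (y i)\<^sup>2) \<le> card I" using s B by simp
  qed auto
  \<comment> \<open>The net is pulled back to a set on which \<open>x\<close> is injective, which
    preserves its cardinality.\<close>
  obtain U where U: "U \<subseteq> S" "T = x ` U" "inj_on x U"
    using T(2) by (metis subset_image_inj)
  show thesis
  proof
    show "finite U" using T(1) U finite_imageD by blast
    show "U \<subseteq> S" by fact
    show "real (card U) \<le> net_base ^ (2 * card J)"
      using T(3) U I by (simp add: card_image net_base_def power2_eq_square)
    fix f assume f: "f \<in> S"
    then obtain g where g: "g \<in> U" "(\<Sum>i\<in>I. (x f i - x g i)\<^sup>2) \<le> (1/4)\<^sup>2 * card I"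
      using T(4)[of "x f"] U by auto
    then have "s\<^sup>2 * (\<Sum>j\<in>J. (cmod (f j - g j))\<^sup>2) \<le> s\<^sup>2 * (B / 16)"
      unfolding xs using s B by (simp add: power2_eq_square)
    then have "(\<Sum>j\<in>J. (cmod (f j - g j))\<^sup>2) \<le> B / 16"
      by (rule mult_left_le_imp_le) (rule zero_less_power[OF s(1)])
    then show "\<exists>g\<in>U. (\<Sum>j\<in>J. (cmod (f j - g j))\<^sup>2) \<le> B / 16"
      using g by blast
  qed
qed

lemma unit_vector_net:
  assumes "0 < d"
  obtains T where "finite T" "\<And>v. v \<in> T \<Longrightarrow> sq d v = 1" "real (card T) \<le> net_base ^ (2 * d)"
    "\<And>v. sq d v = 1 \<Longrightarrow> \<exists>w\<in>T. sq d (\<lambda>i. v i - w i) \<le> 1/16"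
proof -
  obtain T where "finite T" "T \<subseteq> {v. sq d v = 1}" "real (card T) \<le> net_base ^ (2 * card {..<d})"
    "\<And>f. f \<in> {v. sq d v = 1} \<Longrightarrow> \<exists>g\<in>T. (\<Sum>j\<in>{..<d}. (cmod (f j - g j))\<^sup>2) \<le> 1 / 16"
    by (rule complex_net[of "{..<d}" 1 "{v. sq d v = 1}"]) (use assms in \<open>auto simp: sq_def\<close>)
  then show thesis using that[of T] by (auto simp: sq_def)
qed

text \<open>Squared Frobenius distance d/16 between unitaries means 2 d - 2 Re (hs d Z W) is at most
  d/16, so the real overlap is at least 31/32 of \<open>d\<close>, and (31/32)^2 exceeds
  3/4.\<close>

lemma unitary_net:
  assumes d: "0 < d"
  obtains T where "finite T" "\<And>W. W \<in> T \<Longrightarrow> unitary_fun d W" "real (card T) \<le> net_base ^ (2 * d\<^sup>2)"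
    "\<And>Z. unitary_fun d Z \<Longrightarrow> \<exists>W\<in>T. 3/4 \<le> (cmod (hs d Z W))\<^sup>2 / (real d)\<^sup>2"
proof -
  define J where "J = {..<d} \<times> {..<d}"
  define S where "S = {f. unitary_fun d (curry f)}"
  have hsr: "complex_of_real (\<Sum>(m, i)\<in>J. (cmod (Z m i))\<^sup>2) = hs d Z Z" for Z
    unfolding J_def hs_def sum.cartesian_product[symmetric] of_real_sum complex_norm_square
    by (subst sum.swap) (simp only: mult.commute)
  have nrm: "(\<Sum>(m, i)\<in>J. (cmod (Z m i))\<^sup>2) = real d" if "unitary_fun d Z" for Z
  proof -
    have "complex_of_real (\<Sum>(m, i)\<in>J. (cmod (Z m i))\<^sup>2) = of_real (real d)"
      unfolding hsr using hs_self[OF that] by simp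
    then show ?thesis by (simp only: of_real_eq_iff)
  qed
  obtain T where T: "finite T" "T \<subseteq> S" "real (card T) \<le> net_base ^ (2 * card J)"
    "\<And>f. f \<in> S \<Longrightarrow> \<exists>g\<in>T. (\<Sum>j\<in>J. (cmod (f j - g j))\<^sup>2) \<le> real d / 16"
  proof (rule complex_net[of J "real d" S])
    show "finite J" "J \<noteq> {}" "0 < real d" using d by (auto simp: J_def)
    fix f assume "f \<in> S"
    then show "(\<Sum>j\<in>J. (cmod (f j))\<^sup>2) \<le> real d"
      using nrm[of "curry f"] by (simp add: S_def case_prod_unfold)
  qed blast
  show thesis
  proof
    show "finite (curry ` T)" using T by simp
    show "unitary_fun d W" if "W \<in> curry ` T" for W using that T(2) by (auto simp: S_def)
    have "real (card (curry ` T)) \<le> real (card T)" using card_image_le[OF T(1)] by simp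
    then show "real (card (curry ` T)) \<le> net_base ^ (2 * d\<^sup>2)"
      using T(3) by (simp add: J_def card_cartesian_product power2_eq_square)
    fix Z assume Z: "unitary_fun d Z"
    then have "case_prod Z \<in> S" by (simp add: S_def)
    then obtain g where g: "g \<in> T" "(\<Sum>j\<in>J. (cmod (case_prod Z j - g j))\<^sup>2) \<le> real d / 16"
      using T(4) by blast
    define W where "W = curry g"
    have W: "unitary_fun d W" using g T(2) by (auto simp: W_def S_def)
    have "complex_of_real (\<Sum>(m, i)\<in>J. (cmod (Z m i - W m i))\<^sup>2)
         = (\<Sum>i<d. \<Sum>m<d. cnj (Z m i - W m i) * (Z m i - W m i))"
      unfolding J_def sum.cartesian_product[symmetric] of_real_sum complex_norm_square
      by (subst sum.swap) (simp only: mult.commute)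
    also have "\<dots> = hs d Z Z - hs d Z W - hs d W Z + hs d W W"
      by (simp add: hs_def algebra_simps sum.distrib sum_subtractf)
    also have "\<dots> = of_real (2 * real d - 2 * Re (hs d Z W))"
      unfolding hs_self[OF Z] hs_self[OF W] hs_cnj[of d W Z] by (simp add: complex_eq_iff)
    finally have "(\<Sum>(m, i)\<in>J. (cmod (Z m i - W m i))\<^sup>2) = 2 * real d - 2 * Re (hs d Z W)"
      by (simp only: of_real_eq_iff)
    moreover have "(\<Sum>(m, i)\<in>J. (cmod (Z m i - W m i))\<^sup>2) \<le> real d / 16"
      using g(2) by (simp add: W_def case_prod_unfold)
    ultimately have "31/32 * real d \<le> Re (hs d Z W)" by linarith
    also have "\<dots> \<le> cmod (hs d Z W)" by (rule complex_Re_le_cmod)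
    finally have "31/32 \<le> cmod (hs d Z W) / real d" using d by (simp add: field_simps)
    then have "(31/32)\<^sup>2 \<le> (cmod (hs d Z W) / real d)\<^sup>2" by (intro power_mono) auto
    moreover have "(3/4 :: real) \<le> (31/32)\<^sup>2" by (simp add: power2_eq_square)
    ultimately have "3/4 \<le> (cmod (hs d Z W))\<^sup>2 / (real d)\<^sup>2"
      unfolding power_divide[of "cmod (hs d Z W)"] by (rule order.trans[rotated])
    then show "\<exists>W\<in>curry ` T. 3/4 \<le> (cmod (hs d Z W))\<^sup>2 / (real d)\<^sup>2"
      using g W_def by blast
  qed
qed

section \<open>Norms of vectors and control of operator norms by nets\<close>

definition vn :: "nat \<Rightarrow> (nat \<Rightarrow> complex) \<Rightarrow> real" where
  "vn d x = L2_set (\<lambda>i. cmod (x i)) {..<d}"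

lemma vn_sqrt: "vn d x = sqrt (sq d x)"
  by (simp add: vn_def L2_set_def sq_def)

lemma vn_nonneg [simp]: "0 \<le> vn d x" by (simp add: vn_sqrt)

lemma vn_triangle: "vn d (\<lambda>i. x i + y i) \<le> vn d x + vn d y"
proof -
  have "vn d (\<lambda>i. x i + y i) \<le> L2_set (\<lambda>i. cmod (x i) + cmod (y i)) {..<d}"
    unfolding vn_def by (intro L2_set_mono norm_triangle_ineq) auto
  also have "\<dots> \<le> vn d x + vn d y" unfolding vn_def by (rule L2_set_triangle_ineq)
  finally show ?thesis .
qed

lemma vn_scale: "vn d (\<lambda>i. c * x i) = cmod c * vn d x"
  by (simp add: vn_sqrt sq_scale real_sqrt_mult)

lemma ip_le_vn: "cmod (ip d x y) \<le> vn d x * vn d y"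
proof -
  have "cmod (ip d x y) \<le> (\<Sum>i<d. cmod (cnj (x i) * y i))" unfolding ip_def by (rule norm_sum)
  also have "\<dots> = (\<Sum>i<d. \<bar>cmod (x i)\<bar> * \<bar>cmod (y i)\<bar>)" by (simp add: norm_mult)
  also have "\<dots> \<le> vn d x * vn d y" unfolding vn_def by (rule L2_set_mult_ineq)
  finally show ?thesis .
qed

lemma mv_scale: "mv d M (\<lambda>i. c * v i) = (\<lambda>i. c * mv d M v i)"
  by (rule ext) (simp add: mv_def sum_distrib_left mult_ac)

lemma mv_diff: "mv d M (\<lambda>i. v i - w i) = (\<lambda>i. mv d M v i - mv d M w i)"
  by (rule ext) (simp add: mv_def algebra_simps sum_subtractf)

text \<open>A crude Frobenius bound, which makes suprema over the unit sphere well behaved.\<close>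

lemma mv_bounded: "\<exists>B. \<forall>v. sq d v = 1 \<longrightarrow> vn d (mv d M v) \<le> B"
proof (intro exI allI impI)
  fix v assume v: "sq d v = 1"
  have "sq d (mv d M v) \<le> (\<Sum>i<d. sq d (M i))"
    unfolding sq_def[of d "mv d M v"]
  proof (rule sum_mono)
    fix i
    have "mv d M v i = ip d (\<lambda>j. cnj (M i j)) v" by (simp add: mv_def ip_def)
    then have "cmod (mv d M v i) \<le> vn d (\<lambda>j. cnj (M i j)) * vn d v" by (simp only: ip_le_vn)
    also have "\<dots> = sqrt (sq d (M i))" using v by (simp add: vn_sqrt sq_def)
    finally have "(cmod (mv d M v i))\<^sup>2 \<le> (sqrt (sq d (M i)))\<^sup>2" by (intro power_mono) auto
    then show "(cmod (mv d M v i))\<^sup>2 \<le> sq d (M i)" by simp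
  qed
  then show "vn d (mv d M v) \<le> sqrt (\<Sum>i<d. sq d (M i))" by (simp add: vn_sqrt)
qed

text \<open>Self-bounding: with \<open>s\<close> the operator norm, replacing both unit vectors by
  net points costs s/4 each, so \<open>s\<close> is at most t + s/2.\<close>

lemma mv_le_from_net:
  assumes T: "\<And>v. v \<in> T \<Longrightarrow> sq d v = 1"
    and net: "\<And>v. sq d v = 1 \<Longrightarrow> \<exists>w\<in>T. sq d (\<lambda>i. v i - w i) \<le> 1/16"
    and t: "\<And>u v. u \<in> T \<Longrightarrow> v \<in> T \<Longrightarrow> Re (ip d u (mv d M v)) \<le> t"
    and v: "sq d v = 1"
  shows "vn d (mv d M v) \<le> 2 * t"
proof -
  define X where "X = {vn d (mv d M v) | v. sq d v = 1}"
  define s where "s = Sup X"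
  have bdd: "bdd_above X" using mv_bounded[of d M] by (auto simp: X_def bdd_above_def)
  have le_s: "vn d (mv d M v) \<le> s" if "sq d v = 1" for v
    unfolding s_def by (rule cSup_upper[OF _ bdd]) (use that in \<open>auto simp: X_def\<close>)
  have s0: "0 \<le> s" using le_s[OF v] vn_nonneg order.trans by blast
  have le_sv: "vn d (mv d M w) \<le> s * vn d w" for w
  proof (cases "sq d w = 0")
    case True
    then have "\<forall>j<d. w j = 0" by (simp add: sq_def sum_nonneg_eq_0_iff)
    then have "mv d M w = (\<lambda>_. 0)" by (simp add: mv_def fun_eq_iff)
    then have "vn d (mv d M w) = 0" by (simp add: vn_sqrt sq_def)
    then show ?thesis using s0 by simp
  next
    case False
    then have p: "0 < vn d w" using sq_nonneg[of d w] by (simp add: vn_sqrt less_le)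
    define c where "c = complex_of_real (1 / vn d w)"
    have c: "cmod c = 1 / vn d w" using p by (simp add: c_def norm_divide)
    have "sq d (\<lambda>i. c * w i) = 1"
      using p by (simp add: sq_scale c power_divide vn_sqrt)
    from le_s[OF this] have "cmod c * vn d (mv d M w) \<le> s" by (simp add: mv_scale vn_scale)
    then show ?thesis using p by (simp add: c field_simps)
  qed
  have step: "vn d (mv d M v) \<le> t + s / 2" if v: "sq d v = 1" for v
  proof -
    define y where "y = mv d M v"
    obtain w where w: "w \<in> T" "sq d (\<lambda>i. v i - w i) \<le> 1/16" using net[OF v] by blast
    have vw: "vn d (\<lambda>i. v i - w i) \<le> 1/4"
      unfolding vn_sqrt by (rule real_le_lsqrt) (use w in \<open>auto simp: power2_eq_square\<close>)
    have w1: "vn d w = 1" using T[OF w(1)] by (simp add: vn_sqrt)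
    show ?thesis
    proof (cases "vn d y = 0")
      case True
      \<comment> \<open>Nothing forces \<open>t\<close> to be nonnegative. When \<open>v\<close> is
        mapped to zero, the diagonal entry at the nearby net point shows that \<open>t\<close> is at
        least - s/4.\<close>
      have "- t \<le> Re (- ip d w (mv d M w))" using t[OF w(1) w(1)] by simp
      also have "\<dots> \<le> cmod (- ip d w (mv d M w))" by (rule complex_Re_le_cmod)
      also have "\<dots> = cmod (ip d w (\<lambda>i. mv d M v i - mv d M w i) - ip d w y)"
        by (simp add: y_def ip_def algebra_simps sum_subtractf)
      also have "\<dots> \<le> cmod (ip d w (\<lambda>i. mv d M v i - mv d M w i)) + cmod (ip d w y)"
        by (rule norm_triangle_ineq4)
      also have "\<dots> \<le> vn d w * vn d (mv d M (\<lambda>i. v i - w i)) + vn d w * vn d y"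
        unfolding mv_diff by (intro add_mono ip_le_vn)
      also have "\<dots> \<le> s * vn d (\<lambda>i. v i - w i)" using le_sv True w1 by simp
      also have "\<dots> \<le> s * (1/4)" using vw s0 by (intro mult_left_mono)
      finally show ?thesis using True s0 by (simp add: y_def)
    next
      case False
      then have p: "0 < vn d y" using vn_nonneg[of d y] by linarith
      define c where "c = complex_of_real (1 / vn d y)"
      have c: "cmod c = 1 / vn d y" using p by (simp add: c_def norm_divide)
      define u where "u = (\<lambda>i. c * y i)"
      have "vn d u = 1" using p by (simp add: u_def vn_scale c)
      then have u1: "sq d u = 1" by (simp add: vn_sqrt)
      obtain x where x: "x \<in> T" "sq d (\<lambda>i. u i - x i) \<le> 1/16" using net[OF u1] by blast
      have ux: "vn d (\<lambda>i. u i - x i) \<le> 1/4"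
        unfolding vn_sqrt by (rule real_le_lsqrt) (use x in \<open>auto simp: power2_eq_square\<close>)
      have x1: "vn d x = 1" using T[OF x(1)] by (simp add: vn_sqrt)
      have "ip d u y = cnj c * ip d y y" by (simp add: u_def ip_def sum_distrib_left mult_ac)
      also have "\<dots> = of_real (vn d y)"
        using p by (simp add: c_def ip_self) (simp add: vn_sqrt real_div_sqrt flip: of_real_divide)
      finally have "vn d y = Re (ip d u y)" by simp
      also have "ip d u y = ip d x (mv d M w) + ip d (\<lambda>i. u i - x i) y + ip d x (mv d M (\<lambda>i. v i - w i))"
        unfolding mv_diff by (simp add: y_def ip_def algebra_simps sum_subtractf)
      also have "Re \<dots> \<le> t + cmod (ip d (\<lambda>i. u i - x i) y) + cmod (ip d x (mv d M (\<lambda>i. v i - w i)))"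
        unfolding plus_complex.sel using t[OF x(1) w(1)] by (intro add_mono complex_Re_le_cmod)
      also have "\<dots> \<le> t + vn d (\<lambda>i. u i - x i) * vn d y + vn d x * vn d (mv d M (\<lambda>i. v i - w i))"
        by (intro add_mono ip_le_vn order.refl)
      also have "\<dots> \<le> t + 1/4 * s + 1 * (s * (1/4))"
      proof (intro add_mono mult_mono order.refl)
        show "vn d y \<le> s" using le_s[OF v] by (simp add: y_def)
        show "vn d (mv d M (\<lambda>i. v i - w i)) \<le> s * (1/4)"
          using le_sv order.trans mult_left_mono[OF vw s0] by blast
      qed (use ux x1 s0 in auto)
      finally show ?thesis by (simp add: y_def)
    qed
  qed
  have "s \<le> t + s / 2"
    unfolding s_def by (rule cSup_least) (use step v in \<open>auto simp: X_def s_def\<close>)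
  then show ?thesis using le_s[OF v] by simp
qed

text \<open>The scales are unknown, but both images have length 1, so comparing lengths gives |s -
  s'| at most \<open>\<delta>\<close>. Then s' (x - y) = w + (s' - s) x has length at most
  \<open>2 * \<delta>\<close>, and \<open>s'\<close> is at least 1/2.\<close>

lemma unitary_diff_le:
  assumes Z: "unitary_fun d Z" and V: "unitary_fun d V" and s: "1/2 \<le> s" "1/2 \<le> s'"
    and \<delta>: "\<And>v. sq d v = 1 \<Longrightarrow> vn d (\<lambda>i. of_real s * mv d Z v i - of_real s' * mv d V v i) \<le> \<delta>"
    and v: "sq d v = 1"
  shows "vn d (\<lambda>i. mv d Z v i - mv d V v i) \<le> 4 * \<delta>"
proof -
  define x y where "x = mv d Z v" and "y = mv d V v"
  have n: "vn d x = 1" "vn d y = 1" using Z V v by (simp_all add: x_def y_def vn_sqrt sq_mv_unitary)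
  define w where "w = (\<lambda>i. of_real s * x i - of_real s' * y i)"
  have w: "vn d w \<le> \<delta>" using \<delta>[OF v] by (simp add: w_def x_def y_def)
  have "vn d (\<lambda>i. of_real s * x i) \<le> vn d w + vn d (\<lambda>i. of_real s' * y i)"
    using vn_triangle[of d w "\<lambda>i. of_real s' * y i"] by (simp add: w_def)
  then have 1: "s - s' \<le> \<delta>" using s n w by (simp add: vn_scale)
  have "vn d (\<lambda>i. of_real s' * y i) \<le> vn d (\<lambda>i. (-1) * w i) + vn d (\<lambda>i. of_real s * x i)"
    using vn_triangle[of d "\<lambda>i. (-1) * w i" "\<lambda>i. of_real s * x i"] by (simp add: w_def)
  then have 2: "s' - s \<le> \<delta>" using s n w unfolding vn_scale by simp
  have "s' * vn d (\<lambda>i. x i - y i) = vn d (\<lambda>i. of_real s' * (x i - y i))"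
    unfolding vn_scale using s by simp
  also have "(\<lambda>i. of_real s' * (x i - y i)) = (\<lambda>i. w i + of_real (s' - s) * x i)"
    by (simp add: w_def algebra_simps fun_eq_iff)
  also have "vn d \<dots> \<le> vn d w + vn d (\<lambda>i. of_real (s' - s) * x i)" by (rule vn_triangle)
  also have "\<dots> = vn d w + \<bar>s' - s\<bar>" unfolding vn_scale n by (simp only: norm_of_real) simp
  also have "\<dots> \<le> 2 * \<delta>" using w 1 2 by (simp add: abs_if)
  finally have "s' * vn d (\<lambda>i. x i - y i) \<le> 2 * \<delta>" .
  moreover have "1/2 * vn d (\<lambda>i. x i - y i) \<le> s' * vn d (\<lambda>i. x i - y i)"
    using s by (intro mult_right_mono) auto
  ultimately show ?thesis by (simp add: x_def y_def)
qed

section \<open>The sampling algorithm\<close>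

definition mfun :: "complex mat \<Rightarrow> nat \<Rightarrow> nat \<Rightarrow> complex" where
  "mfun A i j = A $$ (i, j)"

lemma adj_carrier [simp]: "A \<in> carrier_mat n m \<Longrightarrow> adj A \<in> carrier_mat m n"
  by (auto simp: adj_def)

lemma adj_index: "A \<in> carrier_mat n m \<Longrightarrow> i < m \<Longrightarrow> j < n \<Longrightarrow> adj A $$ (i, j) = cnj (A $$ (j, i))"
  by (auto simp: adj_def)

lemma mult_index:
  "A \<in> carrier_mat n k \<Longrightarrow> B \<in> carrier_mat k m \<Longrightarrow> i < n \<Longrightarrow> j < m \<Longrightarrow>
   (A * B) $$ (i, j) = (\<Sum>l<k. A $$ (i, l) * B $$ (l, j))"
  by (auto simp: scalar_prod_def atLeast0LessThan)

lemma unitary_fun_mfun: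
  assumes "unitary_mat d U" shows "unitary_fun d (mfun U)"
proof -
  have U: "U \<in> carrier_mat d d" "adj U * U = 1\<^sub>m d" using assms by (auto simp: unitary_mat_def)
  \<comment> \<open>A one-sided inverse of a square matrix is two-sided; this supplies the row
    relations.\<close>
  then have U': "U * adj U = 1\<^sub>m d" using mat_mult_left_right_inverse[of "adj U" d U] by auto
  have "(\<Sum>m<d. cnj (mfun U m i) * mfun U m j) = of_bool (i = j)" if "i < d" "j < d" for i j
  proof -
    have "(\<Sum>m<d. cnj (mfun U m i) * mfun U m j) = (adj U * U) $$ (i, j)"
      using that U by (subst mult_index[of _ d d]) (auto simp: mfun_def adj_index)
    then show ?thesis using that by (simp add: U)
  qed
  moreover have "(\<Sum>m<d. mfun U i m * cnj (mfun U j m)) = of_bool (i = j)" if "i < d" "j < d" for i j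
  proof -
    have "(\<Sum>m<d. mfun U i m * cnj (mfun U j m)) = (U * adj U) $$ (i, j)"
      using that U by (subst mult_index[of _ d d]) (auto simp: mfun_def adj_index)
    then show ?thesis using that by (simp add: U')
  qed
  ultimately show ?thesis by (simp add: unitary_fun_def)
qed

lemma unitary_mat_of_fun:
  assumes "unitary_fun d W" shows "unitary_mat d (mat d d (case_prod W))"
proof -
  define U where "U = mat d d (case_prod W)"
  have U: "U \<in> carrier_mat d d" by (simp add: U_def)
  have Ui: "U $$ (i, j) = W i j" if "i < d" "j < d" for i j using that by (simp add: U_def)
  have "adj U * U = 1\<^sub>m d"
  proof (rule eq_matI)
    fix i j assume "i < dim_row (1\<^sub>m d :: complex mat)" "j < dim_col (1\<^sub>m d :: complex mat)"
    then have ij: "i < d" "j < d" by auto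
    have "(adj U * U) $$ (i, j) = (\<Sum>m<d. cnj (W m i) * W m j)"
      using ij by (subst mult_index[OF adj_carrier[OF U] U]) (auto simp: adj_index[OF U] Ui)
    then show "(adj U * U) $$ (i, j) = (1\<^sub>m d :: complex mat) $$ (i, j)"
      using assms ij by (simp add: unitary_fun_def)
  qed (use U in \<open>auto simp: adj_def\<close>)
  then show ?thesis using U by (simp add: unitary_mat_def U_def)
qed

section \<open>Rank-one states and the measure-and-prepare instrument\<close>

definition outer :: "nat \<Rightarrow> (nat \<Rightarrow> complex) \<Rightarrow> real \<Rightarrow> complex mat" where
  "outer d y c = mat d d (\<lambda>(i, j). of_real c * (y i * cnj (y j)))"

lemma outer_carrier [simp]: "outer d y c \<in> carrier_mat d d"
  by (simp add: outer_def)

lemma outer_index: "i < d \<Longrightarrow> j < d \<Longrightarrow> outer d y c $$ (i, j) = of_real c * (y i * cnj (y j))"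
  by (simp add: outer_def)

text \<open>Rank-one states stay rank-one under conjugation, so a run is described by a vector and a
  real coefficient.\<close>

lemma conj_outer:
  assumes K: "K \<in> carrier_mat d d"
  shows "K * outer d y c * adj K = outer d (mv d (mfun K) y) c"
proof (rule eq_matI)
  fix i j assume "i < dim_row (outer d (mv d (mfun K) y) c)" "j < dim_col (outer d (mv d (mfun K) y) c)"
  then have ij: "i < d" "j < d" by (auto simp: outer_def)
  have "(K * outer d y c * adj K) $$ (i, j) = (\<Sum>l<d. (K * outer d y c) $$ (i, l) * adj K $$ (l, j))"
    using ij K by (intro mult_index[of _ d d]) auto
  also have "\<dots> = (\<Sum>l<d. (\<Sum>m<d. K $$ (i, m) * (of_real c * (y m * cnj (y l)))) * cnj (K $$ (j, l)))"
    using ij K by (intro sum.cong refl) (simp add: mult_index[OF K outer_carrier] adj_index[OF K] outer_index del: index_mult_mat)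
  also have "\<dots> = (\<Sum>l<d. of_real c * (mv d (mfun K) y i * cnj (mfun K j l * y l)))"
    unfolding mv_def mfun_def sum_distrib_left sum_distrib_right
    by (intro sum.cong refl) (simp add: mult_ac)
  also have "\<dots> = of_real c * (mv d (mfun K) y i * cnj (mv d (mfun K) y j))"
    by (simp add: sum_distrib_left[symmetric] mv_def[of _ _ _ j])
  finally show "(K * outer d y c * adj K) $$ (i, j) = outer d (mv d (mfun K) y) c $$ (i, j)"
    using ij by (simp add: outer_def)
qed (use K in \<open>auto simp: outer_def adj_def\<close>)

lemma outer_scale: "outer d (\<lambda>i. s * y i) c = outer d y ((cmod s)\<^sup>2 * c)"
  unfolding outer_def of_real_mult complex_norm_square
  by (intro cong_mat) (auto simp: mult_ac)

text \<open>The prepared vector is not normalised: its squared norm becomes part of the probability of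
  preparing it, which is what makes the joint law of \<open>(b, a)\<close> a density over the product measure.\<close>
definition kmat :: "nat \<Rightarrow> (nat \<Rightarrow> nat) \<times> (nat \<Rightarrow> nat) \<Rightarrow> complex mat" where
  "kmat d = (\<lambda>(a, b). mat d d (\<lambda>(i, j).
     of_real (1 / sqrt (real d * 64 ^ d)) * wvec b i * cnj (wvec a j)))"

lemma kmat_carrier [simp]: "kmat d x \<in> carrier_mat d d"
  by (simp add: kmat_def case_prod_unfold)

lemma kmat_index: "i < d \<Longrightarrow> j < d \<Longrightarrow> kmat d (a, b) $$ (i, j) =
    of_real (1 / sqrt (real d * 64 ^ d)) * wvec b i * cnj (wvec a j)"
  by (simp add: kmat_def)

lemma outer_cong: "(\<And>i. i < d \<Longrightarrow> y i = y' i) \<Longrightarrow> outer d y c = outer d y' c"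
  unfolding outer_def by (intro cong_mat) auto

lemma apply_kraus_kmat:
  "apply_kraus d [kmat d (a, b)] (outer d y c)
    = outer d (wvec b) ((cmod (ip d (wvec a) y))\<^sup>2 / (real d * 64 ^ d) * c)"
proof -
  define k where "k = complex_of_real (1 / sqrt (real d * 64 ^ d))"
  have k: "(cmod k)\<^sup>2 = 1 / (real d * 64 ^ d)" by (simp add: k_def norm_divide power_divide)
  have "apply_kraus d [kmat d (a, b)] (outer d y c) = kmat d (a, b) * outer d y c * adj (kmat d (a, b))"
    by (rule eq_matI) (auto simp: apply_kraus_def adj_def kmat_def)
  also have "\<dots> = outer d (mv d (mfun (kmat d (a, b))) y) c" by (simp add: conj_outer)
  also have "\<dots> = outer d (\<lambda>i. (k * ip d (wvec a) y) * wvec b i) c"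
    by (rule outer_cong)
       (simp add: mv_def mfun_def kmat_index ip_def k_def[symmetric] sum_distrib_left sum_distrib_right mult_ac
         del: of_real_divide)
  also have "\<dots> = outer d (wvec b) ((cmod (ip d (wvec a) y))\<^sup>2 / (real d * 64 ^ d) * c)"
    unfolding outer_scale norm_mult power_mult_distrib k by simp
  finally show ?thesis .
qed

text \<open>Each term is the squared norm of the prepared vector times the projector-like matrix of
  the measured one. These average to \<open>d\<close> and to the identity respectively, and the
  prefactor in \<open>kmat\<close> cancels the rest.\<close>

lemma kmat_complete:
  assumes d: "0 < d" and st: "s < d" "t < d"
  shows "(\<Sum>x\<in>sample_space d. (adj (kmat d x) * kmat d x) $$ (s, t)) = of_bool (s = t)"
proof -
  define D where "D = real d * 64 ^ d"
  have D: "0 < D" using d by (simp add: D_def)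
  have "(adj (kmat d (a, b)) * kmat d (a, b)) $$ (s, t)
      = of_real (1 / D) * (of_real (sq d (wvec b)) * (cnj (wvec a t) * wvec a s))" for a b
  proof -
    have k: "complex_of_real (1 / sqrt D) * of_real (1 / sqrt D) = of_real (1 / D)"
      using D by (simp flip: of_real_mult)
    have "(adj (kmat d (a, b)) * kmat d (a, b)) $$ (s, t)
       = (\<Sum>m<d. cnj (of_real (1 / sqrt D) * wvec b m * cnj (wvec a s)) * (of_real (1 / sqrt D) * wvec b m * cnj (wvec a t)))"
      using st by (subst mult_index[OF adj_carrier[OF kmat_carrier] kmat_carrier])
        (auto simp: adj_index[OF kmat_carrier] kmat_index D_def)
    also have "\<dots> = (\<Sum>m<d. (of_real (1 / sqrt D) * of_real (1 / sqrt D)) * ((cnj (wvec b m) * wvec b m) * (cnj (wvec a t) * wvec a s)))"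
      by (intro sum.cong refl) (simp add: mult_ac)
    also have "\<dots> = of_real (1 / D) * (ip d (wvec b) (wvec b) * (cnj (wvec a t) * wvec a s))"
      unfolding k by (simp add: ip_def sum_distrib_left sum_distrib_right)
    finally show ?thesis by (simp only: ip_self)
  qed
  then have "(\<Sum>x\<in>sample_space d. (adj (kmat d x) * kmat d x) $$ (s, t))
      = (\<Sum>a\<in>words d. \<Sum>b\<in>words d. of_real (1 / D) * (of_real (sq d (wvec b)) * (cnj (wvec a t) * wvec a s)))"
    unfolding sample_space_def sum.cartesian_product by (intro sum.cong) auto
  also have "\<dots> = of_real (1 / D) * (of_real (\<Sum>b\<in>words d. sq d (wvec b)) * (\<Sum>a\<in>words d. cnj (wvec a t) * wvec a s))"
    by (simp add: sum_distrib_left sum_distrib_right mult_ac)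
  also have "(\<Sum>b\<in>words d. sq d (wvec b)) = real d * 8 ^ d"
    using wavg_sq[of d] by (simp add: wavg_def field_simps)
  also have "(\<Sum>a\<in>words d. cnj (wvec a t) * wvec a s) = 8 ^ d * of_bool (t = s)"
    using wavg_quadratic_monomial[OF st(2,1)] by (simp add: wavg_def field_simps)
  also have "complex_of_real (1 / D) * (of_real (real d * 8 ^ d) * (8 ^ d * of_bool (t = s))) = of_bool (s = t)"
  proof -
    have "(64::complex) ^ d = 8 ^ d * 8 ^ d" by (simp add: power_mult_distrib[symmetric])
    then show ?thesis using d by (simp add: D_def)
  qed
  finally show ?thesis .
qed

text \<open>An outcome is a pair (word measured, word prepared next), and histories are listed latest first;
  a sample pairs the word prepared at one step with the word measured at the following step.\<close>
fun samples :: "('w \<times> 'w) list \<Rightarrow> ('w \<times> 'w) list" where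
  "samples (y # x # xs) = (snd x, fst y) # samples (x # xs)"
| "samples _ = []"

fun cur :: "nat \<Rightarrow> (nat \<Rightarrow> nat \<Rightarrow> complex) \<Rightarrow> ((nat \<Rightarrow> nat) \<times> (nat \<Rightarrow> nat)) list \<Rightarrow> nat \<Rightarrow> complex" where
  "cur d Z [] = (\<lambda>i. of_bool (i = 0))"
| "cur d Z (x # xs) = mv d Z (wvec (snd x))"

text \<open>The coefficient of the rank-one state. It omits the squared norm of the last prepared
  vector, which enters only through the next overlap or the final trace.\<close>

fun wt :: "nat \<Rightarrow> (nat \<Rightarrow> nat \<Rightarrow> complex) \<Rightarrow> ((nat \<Rightarrow> nat) \<times> (nat \<Rightarrow> nat)) list \<Rightarrow> real" where
  "wt d Z [] = 1"
| "wt d Z (x # xs) = (cmod (ip d (wvec (fst x)) (cur d Z xs)))\<^sup>2 / (real d * 64 ^ d) * wt d Z xs"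

lemma samples_Cons: "xs \<noteq> [] \<Longrightarrow> samples (y # xs) = (snd (hd xs), fst y) # samples xs"
  by (cases xs) auto

lemma cur_nonempty: "xs \<noteq> [] \<Longrightarrow> cur d Z xs = mv d Z (wvec (snd (hd xs)))"
  by (cases xs) auto

lemma tuples_nonempty: "xs \<in> tuples S (Suc m) \<Longrightarrow> xs \<noteq> []"
  by (auto simp: tuples_def)

text \<open>Consecutive outcomes decouple into independent samples: the overlap of a measured word
  with the previously prepared one is the factor \<open>sample_prob\<close>. Of \<open>Suc m\<close>
  outcomes, the first measured and the last prepared word belong to no sample.\<close>

lemma sum_wt_tuples:
  assumes d: "0 < d"
  shows "(\<Sum>xs\<in>tuples (sample_space d) (Suc m). wt d Z xs * F (samples xs) (snd (hd xs)))
    = 1 / (real d * 8 ^ d) * (\<Sum>b\<in>words d. \<Sum>s\<in>tuples (sample_space d) m.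
         prod_list (map (sample_prob d Z) s) * F s b)"
proof (induction m arbitrary: F)
  case 0
  \<comment> \<open>The first measurement acts on a fixed basis vector, whose squared overlap with a
    random word has mean 1; the first measured word therefore sums out.\<close>
  have a0: "(\<Sum>a\<in>words d. (cmod (ip d (wvec a) (\<lambda>i. of_bool (i = 0))))\<^sup>2) = 8 ^ d"
  proof -
    have "ip d (wvec a) (\<lambda>i. of_bool (i = 0)) = cnj (wvec a 0)" for a
    proof -
      have "ip d (wvec a) (\<lambda>i. of_bool (i = 0)) = (\<Sum>i<d. if i = 0 then cnj (wvec a i) else 0)"
        unfolding ip_def by (intro sum.cong) auto
      then show ?thesis using d by simp
    qed
    moreover have "complex_of_real (\<Sum>a\<in>words d. (cmod (wvec a 0))\<^sup>2) = of_real (8 ^ d)"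
      unfolding of_real_sum complex_norm_square mult.commute[of _ "cnj _"]
      using wavg_quadratic_monomial[OF d d] by (simp add: wavg_def field_simps)
    ultimately show ?thesis by (simp only: of_real_eq_iff complex_mod_cnj)
  qed
  have 64: "(64::real) ^ d = 8 ^ d * 8 ^ d" by (simp add: power_mult_distrib[symmetric])
  have "(\<Sum>xs\<in>tuples (sample_space d) (Suc 0). wt d Z xs * F (samples xs) (snd (hd xs)))
    = (\<Sum>a\<in>words d. \<Sum>b\<in>words d. (cmod (ip d (wvec a) (\<lambda>i. of_bool (i = 0))))\<^sup>2 * (1 / (real d * 64 ^ d) * F [] b))"
    unfolding sum_tuples_Suc sample_space_def tuples_0 sum.cartesian_product'
    by (intro sum.cong refl) simp
  also have "\<dots> = 8 ^ d * (\<Sum>b\<in>words d. 1 / (real d * 64 ^ d) * F [] b)"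
    unfolding sum_distrib_left[symmetric] sum_distrib_right[symmetric] a0 ..
  finally show ?case by (simp add: sum_distrib_left 64)
next
  case (Suc m)
  let ?W = "words d" and ?O = "sample_space d" and ?p = "sample_prob d Z"
  let ?c = "1 / (real d * 8 ^ d)"
  have "(\<Sum>xs\<in>tuples ?O (Suc (Suc m)). wt d Z xs * F (samples xs) (snd (hd xs)))
    = (\<Sum>y\<in>?O. \<Sum>xs\<in>tuples ?O (Suc m). wt d Z xs * (?p (snd (hd xs), fst y) *
          F ((snd (hd xs), fst y) # samples xs) (snd y)))"
    unfolding sum_tuples_Suc[of _ _ "Suc m"]
    by (intro sum.cong refl) (simp add: samples_Cons cur_nonempty tuples_nonempty sample_prob_def)
  \<comment> \<open>The newest outcome is summed inside, so that the induction hypothesis applies to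
    the older history with this inner sum as its \<open>F\<close>. This is why \<open>F\<close> is
    arbitrary and may see the last prepared word.\<close>
  also have "\<dots> = (\<Sum>xs\<in>tuples ?O (Suc m). wt d Z xs * (\<Sum>y\<in>?O. ?p (snd (hd xs), fst y) *
          F ((snd (hd xs), fst y) # samples xs) (snd y)))"
    unfolding sum_distrib_left by (rule sum.swap)
  also have "\<dots> = ?c * (\<Sum>b'\<in>?W. \<Sum>s\<in>tuples ?O m.
         prod_list (map ?p s) * (\<Sum>y\<in>?O. ?p (b', fst y) * F ((b', fst y) # s) (snd y)))"
    by (rule Suc.IH[of "\<lambda>s b'. \<Sum>y\<in>?O. ?p (b', fst y) * F ((b', fst y) # s) (snd y)"])
  also have "(\<Sum>b'\<in>?W. \<Sum>s\<in>tuples ?O m.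
         prod_list (map ?p s) * (\<Sum>y\<in>?O. ?p (b', fst y) * F ((b', fst y) # s) (snd y)))
    = (\<Sum>b'\<in>?W. \<Sum>s\<in>tuples ?O m. \<Sum>a\<in>?W. \<Sum>b\<in>?W. prod_list (map ?p ((b', a) # s)) * F ((b', a) # s) b)"
    unfolding sample_space_def sum_distrib_left sum.cartesian_product'
    by (intro sum.cong refl) (simp add: mult_ac)
  also have "\<dots> = (\<Sum>b'\<in>?W. \<Sum>a\<in>?W. \<Sum>b\<in>?W. \<Sum>s\<in>tuples ?O m. prod_list (map ?p ((b', a) # s)) * F ((b', a) # s) b)"
    by (rule sum.cong[OF refl], subst sum.swap, rule sum.cong[OF refl], rule sum.swap)
  also have "\<dots> = (\<Sum>\<omega>\<in>?O. \<Sum>b\<in>?W. \<Sum>s\<in>tuples ?O m. prod_list (map ?p (\<omega> # s)) * F (\<omega> # s) b)"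
    unfolding sample_space_def sum.cartesian_product' ..
  also have "\<dots> = (\<Sum>b\<in>?W. \<Sum>s\<in>tuples ?O (Suc m). prod_list (map ?p s) * F s b)"
    unfolding sum_tuples_Suc by (rule sum.swap)
  finally show ?case .
qed

lemma bij_betw_tuples:
  assumes "bij_betw e A B"
  shows "bij_betw (\<lambda>h. map e (rev h)) (tuples A n) (tuples B n)"
proof (rule bij_betw_byWitness[where f' = "\<lambda>h. rev (map (inv_into A e) h)"])
  have l: "inv_into A e (e x) = x" if "x \<in> A" for x
    using assms that by (simp add: bij_betw_inv_into_left)
  have r: "e (inv_into A e y) = y" "inv_into A e y \<in> A" if "y \<in> B" for y
    using assms that bij_betw_inv_into_right bij_betw_apply bij_betw_inv_into by metis+
  show "\<forall>h\<in>tuples A n. rev (map (inv_into A e) (map e (rev h))) = h"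
    using l by (auto simp: tuples_def rev_map map_idI subset_iff)
  show "\<forall>h\<in>tuples B n. map e (rev (rev (map (inv_into A e) h))) = h"
    using r by (auto simp: tuples_def map_idI subset_iff)
  show "(\<lambda>h. map e (rev h)) ` tuples A n \<subseteq> tuples B n"
    using bij_betw_apply[OF assms] by (auto simp: tuples_def subset_iff)
  show "(\<lambda>h. rev (map (inv_into A e) h)) ` tuples B n \<subseteq> tuples A n"
    using r by (auto simp: tuples_def subset_iff)
qed

lemma mtrace_outer: "Re (mtrace (outer d y c)) = c * sq d y"
proof -
  have "mtrace (outer d y c) = of_real c * of_real (sq d y)"
    unfolding sq_def of_real_sum complex_norm_square sum_distrib_left
    by (simp add: mtrace_def outer_def)
  then show ?thesis by simp
qed

text \<open>The same instrument acts at every step and only the output depends on the history. The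
  \<open>n\<close> queries lie between \<open>n + 1\<close> instruments, which yields exactly
  \<open>n\<close> independent samples for the classical map \<open>f\<close>.\<close>

lemma sampling_algorithm:
  assumes d: "0 < d" and f: "\<And>s. unitary_mat d (f s)"
  obtains A where "wf_alg d A" "queries A = n"
    "\<And>Z \<epsilon>. unitary_mat d Z \<Longrightarrow> fail_prob d Z A \<epsilon> =
       iid_prob (sample_space d) (sample_prob d (mfun Z)) n (\<lambda>s. pudist d Z (f s) > \<epsilon>)"
proof -
  let ?O = "sample_space d"
  define N where "N = card ?O"
  have finO: "finite ?O" by (simp add: sample_space_def)
  obtain e where e: "bij_betw e {..<N} ?O"
    using ex_bij_betw_nat_finite[OF finO] by (auto simp: N_def atLeast0LessThan)
  define A where "A = \<lparr>queries = n, nout = (\<lambda>_ _. N), kraus = (\<lambda>_ _ j. [kmat d (e j)]),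
      outp = (\<lambda>h. f (samples (map e (rev h))))\<rparr>"
  have vh: "{h. valid_hist A h \<and> length h = Suc (queries A)} = tuples {..<N} (Suc n)"
    by (auto simp: valid_hist_def A_def tuples_def set_conv_nth subset_iff)
  have "wf_alg d A"
  proof -
    have "(\<Sum>j<N. (adj (kmat d (e j)) * kmat d (e j)) $$ (a, b)) = (1\<^sub>m d :: complex mat) $$ (a, b)"
      if "a < d" "b < d" for a b
      using sum.reindex_bij_betw[OF e, of "\<lambda>x. (adj (kmat d x) * kmat d x) $$ (a, b)"]
        kmat_complete[OF d that] that by simp
    then show ?thesis unfolding wf_alg_def by (auto simp: A_def f)
  qed
  moreover have "queries A = n" by (simp add: A_def)
  moreover have "fail_prob d Z A \<epsilon> = iid_prob ?O (sample_prob d (mfun Z)) n (\<lambda>s. pudist d Z (f s) > \<epsilon>)"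
    if Z: "unitary_mat d Z" for Z \<epsilon>
  proof -
    have Zc: "Z \<in> carrier_mat d d" using Z by (simp add: unitary_mat_def)
    have init: "init_state d = outer d (\<lambda>i. of_bool (i = 0)) 1"
      unfolding init_state_def outer_def by (intro cong_mat) auto
    have step: "apply_kraus d [kmat d x] (outer d (cur d (mfun Z) xs) (wt d (mfun Z) xs))
        = outer d (wvec (snd x)) (wt d (mfun Z) (x # xs))" for x xs
      using apply_kraus_kmat[of d "fst x" "snd x" "cur d (mfun Z) xs" "wt d (mfun Z) xs"] by simp
    have run: "run_rev d Z A hr = outer d (cur d (mfun Z) (map e hr)) (wt d (mfun Z) (map e hr))"
      if "length hr \<le> n" for hr
      using that
    proof (induction hr)
      case Nil
      then show ?case by (simp add: init)
    next
      case (Cons j hr)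
      then have "run_rev d Z A (j # hr) = Z * outer d (wvec (snd (e j))) (wt d (mfun Z) (map e (j # hr))) * adj Z"
        by (simp add: A_def step[unfolded wt.simps] Let_def)
      then show ?case by (simp add: conj_outer[OF Zc])
    qed
    have tr: "Re (mtrace (run d Z A h)) = (\<lambda>xs. wt d (mfun Z) xs * sq d (wvec (snd (hd xs)))) (map e (rev h))"
      if h: "h \<in> tuples {..<N} (Suc n)" for h
    proof -
      obtain j hr where hr: "rev h = j # hr" using tuples_nonempty[OF h] by (cases "rev h") auto
      have len: "length hr = n" using h arg_cong[OF hr, of length] by (simp add: tuples_def)
      have "run d Z A h = outer d (wvec (snd (e j))) (wt d (mfun Z) (map e (j # hr)))"
        using run[of hr] len step[of "e j" "map e hr"] by (simp add: run_def hr A_def)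
      then show ?thesis by (simp add: mtrace_outer hr)
    qed
    let ?bad = "\<lambda>s. of_bool (pudist d Z (f s) > \<epsilon>) :: real"
    have "fail_prob d Z A \<epsilon> = (\<Sum>h\<in>tuples {..<N} (Suc n).
        (\<lambda>xs. wt d (mfun Z) xs * (?bad (samples xs) * sq d (wvec (snd (hd xs))))) (map e (rev h)))"
      unfolding fail_prob_def vh by (intro sum.cong refl) (simp add: tr, simp add: A_def)
    also have "\<dots> = (\<Sum>xs\<in>tuples ?O (Suc n). wt d (mfun Z) xs * (?bad (samples xs) * sq d (wvec (snd (hd xs)))))"
      by (rule sum.reindex_bij_betw[OF bij_betw_tuples[OF e]])
    also have "\<dots> = 1 / (real d * 8 ^ d) * (\<Sum>b\<in>words d. \<Sum>s\<in>tuples ?O n.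
         prod_list (map (sample_prob d (mfun Z)) s) * (?bad s * sq d (wvec b)))"
      by (rule sum_wt_tuples[OF d, where F = "\<lambda>s b. ?bad s * sq d (wvec b)"])
    also have "\<dots> = 1 / (real d * 8 ^ d) * ((\<Sum>b\<in>words d. sq d (wvec b)) *
         iid_prob ?O (sample_prob d (mfun Z)) n (\<lambda>s. pudist d Z (f s) > \<epsilon>))"
      unfolding iid_prob_def sum_product by (simp add: mult_ac)
    \<comment> \<open>The last prepared vector is never measured; its squared norms sum to the
      inverse of the prefactor.\<close>
    also have "(\<Sum>b\<in>words d. sq d (wvec b)) = real d * 8 ^ d"
      using wavg_sq[of d] by (simp add: wavg_def field_simps)
    finally show ?thesis using d by simp
  qed
  ultimately show thesis using that by blast
qed

section \<open>From coordinate bounds to \<open>pudist\<close>\<close>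

lemma vnorm_vec: "vnorm (vec d v) = vn d v"
  by (simp add: vnorm_def vn_sqrt sq_def)

lemma pudist_le:
  assumes d: "0 < d" and Z: "Z \<in> carrier_mat d d" and V: "V \<in> carrier_mat d d" and \<phi>: "cmod \<phi> = 1"
    and le: "\<And>v. sq d v = 1 \<Longrightarrow> vn d (\<lambda>i. \<phi> * mv d (mfun Z) v i - mv d (mfun V) v i) \<le> \<epsilon>"
  shows "pudist d Z V \<le> \<epsilon>"
proof -
  define X where "X M = {vnorm (M *\<^sub>v v) | v. v \<in> carrier_vec d \<and> vnorm v = 1}" for M :: "complex mat"
  have mvv: "vnorm (M *\<^sub>v v) = vn d (mv d (mfun M) (\<lambda>i. v $ i))"
    if "M \<in> carrier_mat d d" "v \<in> carrier_vec d" for M v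
  proof -
    have "M *\<^sub>v v = vec d (mv d (mfun M) (\<lambda>i. v $ i))"
      using that by (intro eq_vecI) (auto simp: mv_def mfun_def scalar_prod_def atLeast0LessThan)
    then show ?thesis by (simp add: vnorm_vec)
  qed
  have unit: "sq d (\<lambda>i. v $ i) = 1" if "v \<in> carrier_vec d" "vnorm v = 1" for v
    using that by (simp add: vnorm_def sq_def)
  have ne: "X M \<noteq> {}" for M
  proof -
    have "sq d (\<lambda>i. of_bool (i = 0)) = (\<Sum>i<d. if i = 0 then 1 else 0)"
      unfolding sq_def by (intro sum.cong) auto
    then have "vnorm (vec d (\<lambda>i. of_bool (i = 0))) = 1" using d by (simp add: vnorm_vec vn_sqrt)
    then show ?thesis unfolding X_def by (auto intro!: exI[of _ "vec d (\<lambda>i. of_bool (i = 0))"])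
  qed
  \<comment> \<open>This bounds the set in \<open>pudist\<close> from below, as
    \<open>cInf_lower\<close> requires. The supremum in \<open>opnorm\<close> must first be known to
    range over a nonempty bounded set.\<close>
  have nonneg: "0 \<le> opnorm d M" if M: "M \<in> carrier_mat d d" for M
  proof -
    obtain B where B: "\<forall>v. sq d v = 1 \<longrightarrow> vn d (mv d (mfun M) v) \<le> B" using mv_bounded by blast
    have "x \<le> B" if x: "x \<in> X M" for x
    proof -
      obtain v where "v \<in> carrier_vec d" "vnorm v = 1" "x = vnorm (M *\<^sub>v v)"
        using x by (auto simp: X_def)
      then show ?thesis using B unit[of v] mvv[OF M] by auto
    qed
    then have "bdd_above (X M)" by (auto simp: bdd_above_def)
    moreover obtain x where x: "x \<in> X M" using ne by blast
    ultimately have "x \<le> Sup (X M)" by (intro cSup_upper)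
    moreover have "0 \<le> x" using x by (auto simp: X_def mvv[OF M])
    ultimately show ?thesis by (simp add: opnorm_def X_def)
  qed
  have mf: "mv d (mfun (\<phi> \<cdot>\<^sub>m Z - V)) v i = \<phi> * mv d (mfun Z) v i - mv d (mfun V) v i" if "i < d" for v i
  proof -
    have "mv d (mfun (\<phi> \<cdot>\<^sub>m Z - V)) v i = (\<Sum>j<d. (\<phi> * Z $$ (i, j) - V $$ (i, j)) * v j)"
      unfolding mv_def mfun_def using that Z V by (intro sum.cong) auto
    then show ?thesis
      by (simp add: mv_def mfun_def algebra_simps sum_subtractf sum_distrib_left)
  qed
  have "opnorm d (\<phi> \<cdot>\<^sub>m Z - V) \<le> \<epsilon>"
    unfolding opnorm_def X_def[symmetric]
  proof (rule cSup_least[OF ne])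
    fix x assume "x \<in> X (\<phi> \<cdot>\<^sub>m Z - V)"
    then obtain v where v: "v \<in> carrier_vec d" "vnorm v = 1" "x = vnorm ((\<phi> \<cdot>\<^sub>m Z - V) *\<^sub>v v)"
      by (auto simp: X_def)
    have "x = vn d (mv d (mfun (\<phi> \<cdot>\<^sub>m Z - V)) (\<lambda>i. v $ i))"
      unfolding v(3) by (rule mvv[OF minus_carrier_mat[OF V] v(1)])
    also have "\<dots> = vn d (\<lambda>i. \<phi> * mv d (mfun Z) (\<lambda>i. v $ i) i - mv d (mfun V) (\<lambda>i. v $ i) i)"
      by (simp add: vn_sqrt sq_def mf)
    finally show "x \<le> \<epsilon>" using le[OF unit[OF v(1,2)]] by simp
  qed
  moreover have "pudist d Z V \<le> opnorm d (\<phi> \<cdot>\<^sub>m Z - V)"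
    unfolding pudist_def
  proof (rule cInf_lower)
    show "bdd_below {opnorm d (\<phi> \<cdot>\<^sub>m Z - V) |\<phi>. cmod \<phi> = 1}"
      unfolding bdd_below_def using nonneg[OF minus_carrier_mat[OF V]] by (intro exI[of _ 0]) auto
  qed (use \<phi> in auto)
  ultimately show ?thesis by simp
qed

lemma pudist_le_2:
  assumes "0 < d" "unitary_mat d Z" "unitary_mat d V"
  shows "pudist d Z V \<le> 2"
proof (rule pudist_le[where \<phi> = 1])
  fix v assume v: "sq d v = 1"
  have "vn d (\<lambda>i. 1 * mv d (mfun Z) v i - mv d (mfun V) v i)
      = vn d (\<lambda>i. mv d (mfun Z) v i + (-1) * mv d (mfun V) v i)" by simp
  also have "\<dots> \<le> vn d (mv d (mfun Z) v) + vn d (\<lambda>i. (-1) * mv d (mfun V) v i)" by (rule vn_triangle)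
  also have "\<dots> = 2"
    unfolding vn_scale using assms v by (simp add: vn_sqrt sq_mv_unitary unitary_fun_mfun)
  finally show "vn d (\<lambda>i. 1 * mv d (mfun Z) v i - mv d (mfun V) v i) \<le> 2" .
qed (use assms in \<open>auto simp: unitary_mat_def\<close>)

section \<open>Two-stage estimation\<close>

lemma unitary_fun_phase:
  assumes "unitary_fun d Z" "cmod \<phi> = 1"
  shows "unitary_fun d (\<lambda>i j. \<phi> * Z i j)"
proof -
  have "\<phi> * cnj \<phi> = 1" using assms(2) complex_norm_square[of \<phi>] by simp
  then have "cnj (\<phi> * a) * (\<phi> * b) = cnj a * b" "(\<phi> * a) * cnj (\<phi> * b) = a * cnj b" for a b
    by (simp_all add: mult.commute mult.left_commute)
  then show ?thesis using assms(1) unfolding unitary_fun_def by (simp only:)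
qed

lemma unitary_fun_id: "unitary_fun d (\<lambda>i j. of_bool (i = j))"
proof -
  have "(\<Sum>m<d. cnj (of_bool (m = i)) * of_bool (m = j)) = (\<Sum>m<d. if m = i then of_bool (i = j) else 0)"
    "(\<Sum>m<d. of_bool (i = m) * cnj (of_bool (j = m))) = (\<Sum>m<d. if m = i then of_bool (i = j) else 0)" for i j
    by (intro sum.cong; auto)+
  then show ?thesis by (simp add: unitary_fun_def)
qed

lemma mv_phase: "mv d (\<lambda>i j. \<phi> * Z i j) v = (\<lambda>i. \<phi> * mv d Z v i)"
  by (rule ext) (simp add: mv_def sum_distrib_left mult.assoc)

text \<open>A net of size \<open>net_base ^ k\<close> costs at most 36 k in the exponent, since 3 is
  at most \<open>exp 2\<close>. The term \<open>ln (4 / \<eta>)\<close> turns the two-sided tail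
  into \<open>\<eta> / 2\<close>.\<close>

lemma union_tail_le:
  fixes c n v t \<eta> :: real
  assumes c: "c \<le> net_base ^ k" and v: "0 < v" and \<eta>: "0 < \<eta>"
    and n: "(36 * real k + ln (4 / \<eta>)) * (4 * v) \<le> n * t\<^sup>2"
  shows "c * (2 * exp (- n * t\<^sup>2 / (4 * v))) \<le> \<eta> / 2"
proof -
  have "(3::real) \<le> exp 2" using exp_ge_add_one_self[of 2] by simp
  then have "net_base \<le> exp 36"
    unfolding net_base_def using mult_right_mono[of 3 "exp 2" "exp 34 :: real"] by (simp flip: exp_add)
  then have "c \<le> exp 36 ^ k"
    by (intro order.trans[OF c] power_mono) (auto simp: net_base_def)
  also have "\<dots> = exp (36 * real k)" by (simp add: exp_of_nat_mult[symmetric] mult.commute)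
  finally have c': "c \<le> exp (36 * real k)" .
  have "36 * real k + ln (4 / \<eta>) \<le> n * t\<^sup>2 / (4 * v)"
    using n v by (simp add: pos_le_divide_eq)
  then have "exp (- n * t\<^sup>2 / (4 * v)) \<le> exp (- (36 * real k) - ln (4 / \<eta>))" by simp
  also have "\<dots> = exp (- (36 * real k)) * (\<eta> / 4)"
    using \<eta> by (simp add: exp_diff)
  finally have "c * (2 * exp (- n * t\<^sup>2 / (4 * v))) \<le> exp (36 * real k) * (2 * (exp (- (36 * real k)) * (\<eta> / 4)))"
    using c' by (intro mult_mono) auto
  also have "\<dots> = \<eta> / 2" by (simp add: exp_minus)
  finally show ?thesis .
qed

text \<open>The tail bound with variance \<open>8 * C6\<close> and \<open>t = 1/6\<close>: the
  clamping level is then \<open>96 * C6\<close> and the deviation 1/4.\<close>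

lemma reference_stage:
  assumes d: "0 < d" and T: "finite T" "\<And>W. W \<in> T \<Longrightarrow> unitary_fun d W" "real (card T) \<le> net_base ^ (2 * d\<^sup>2)"
    and \<eta>: "0 < \<eta>" and n: "(36 * real (2 * d\<^sup>2) + ln (4 / \<eta>)) * (32 * C6) \<le> real n * (1/6)\<^sup>2"
    and Z: "unitary_fun d Z"
  shows "iid_prob (sample_space d) (sample_prob d Z) n (\<lambda>xs. \<exists>W\<in>T. real n * (1/4) <
     \<bar>clamped_sum (96 * C6) (overlap_stat d W) xs
      - real n * ((cmod (hs d Z W))\<^sup>2 / (real d)\<^sup>2 + 1 + 2 / real d)\<bar>) \<le> \<eta> / 2"
proof -
  have "iid_prob (sample_space d) (sample_prob d Z) n (\<lambda>xs. \<exists>W\<in>T. real n * (1/4) <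
     \<bar>clamped_sum (96 * C6) (overlap_stat d W) xs
      - real n * ((cmod (hs d Z W))\<^sup>2 / (real d)\<^sup>2 + 1 + 2 / real d)\<bar>)
    \<le> real (card T) * (2 * exp (- real n * (1/6)\<^sup>2 / (4 * (8 * C6))))"
  proof (rule iid_prob_union_bound[OF sample_prob_nonneg T(1)])
    fix W assume "W \<in> T"
    then have W: "unitary_fun d W" by (rule T)
    show "iid_prob (sample_space d) (sample_prob d Z) n (\<lambda>xs. real n * (1/4) <
     \<bar>clamped_sum (96 * C6) (overlap_stat d W) xs
      - real n * ((cmod (hs d Z W))\<^sup>2 / (real d)\<^sup>2 + 1 + 2 / real d)\<bar>)
      \<le> 2 * exp (- real n * (1/6)\<^sup>2 / (4 * (8 * C6)))"
      using clamped_sum_tail[OF sample_prob_nonneg sum_sample_prob_1[OF Z d]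
          overlap_stat_second_moment[OF Z W d] _ _ overlap_stat_mean[OF Z W d], of "1/6" n]
      by simp
  qed
  also have "\<dots> \<le> \<eta> / 2"
    by (rule union_tail_le[OF T(3)]) (use \<eta> n in \<open>auto simp: mult_ac\<close>)
  finally show ?thesis .
qed

text \<open>The tail bound with variance \<open>4 * C6 * real d\<close>, united over pairs of net
  vectors, which doubles the exponent \<open>2 * d\<close> of the net size.\<close>

lemma entry_stage:
  assumes d: "0 < d" and T: "finite T" "\<And>v. v \<in> T \<Longrightarrow> sq d v = 1" "real (card T) \<le> net_base ^ (2 * d)"
    and \<eta>: "0 < \<eta>" and t: "0 < t"
    and n: "(36 * real (4 * d) + ln (4 / \<eta>)) * (16 * C6 * real d) \<le> real n * t\<^sup>2"
    and Z: "unitary_fun d Z" and R: "unitary_fun d R"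
  shows "iid_prob (sample_space d) (sample_prob d Z) n (\<lambda>xs. \<exists>(u, v)\<in>T \<times> T. real n * (3/2 * t) <
     \<bar>clamped_sum (8 * C6 * real d / t) (entry_stat d R u v) xs
      - real n * (Re (hs d Z R / of_nat d * ip d u (mv d Z v)) + (1 + 2 / real d) * Re (ip d u (mv d R v)))\<bar>)
     \<le> \<eta> / 2"
proof -
  have "iid_prob (sample_space d) (sample_prob d Z) n (\<lambda>xs. \<exists>(u, v)\<in>T \<times> T. real n * (3/2 * t) <
     \<bar>clamped_sum (8 * C6 * real d / t) (entry_stat d R u v) xs
      - real n * (Re (hs d Z R / of_nat d * ip d u (mv d Z v)) + (1 + 2 / real d) * Re (ip d u (mv d R v)))\<bar>)
     \<le> real (card (T \<times> T)) * (2 * exp (- real n * t\<^sup>2 / (4 * (4 * C6 * real d))))"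
  proof (rule iid_prob_union_bound[OF sample_prob_nonneg])
    fix w assume "w \<in> T \<times> T"
    then obtain u v where uv: "w = (u, v)" "sq d u = 1" "sq d v = 1" using T(2) by auto
    show "iid_prob (sample_space d) (sample_prob d Z) n (\<lambda>xs. case w of (u, v) \<Rightarrow> real n * (3/2 * t) <
     \<bar>clamped_sum (8 * C6 * real d / t) (entry_stat d R u v) xs
      - real n * (Re (hs d Z R / of_nat d * ip d u (mv d Z v)) + (1 + 2 / real d) * Re (ip d u (mv d R v)))\<bar>)
      \<le> 2 * exp (- real n * t\<^sup>2 / (4 * (4 * C6 * real d)))"
    proof -
      have L: "8 * C6 * real d / t = 2 * (4 * C6 * real d) / t" by simp
      show ?thesis
        unfolding uv(1) prod.case L
        by (rule clamped_sum_tail[OF sample_prob_nonneg sum_sample_prob_1[OF Z d]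
              entry_stat_second_moment[OF Z R d uv(2,3)] _ t entry_stat_mean[OF Z d]]) (use d in simp)
    qed
  qed (use T in simp)
  also have "\<dots> \<le> \<eta> / 2"
  proof (rule union_tail_le[where k = "4 * d"])
    have "real (card (T \<times> T)) \<le> net_base ^ (2 * d) * net_base ^ (2 * d)"
      unfolding card_cartesian_product of_nat_mult using T(3)
      by (intro mult_mono) (auto simp: net_base_def)
    then show "real (card (T \<times> T)) \<le> net_base ^ (4 * d)" by (simp add: power_add[symmetric])
  qed (use d \<eta> n in \<open>auto simp: mult_ac\<close>)
  finally show ?thesis .
qed

text \<open>Two unitaries that explain the same data \<open>S\<close> are close. The offset
  \<open>E\<close> cancels in the difference, leaving entries at most \<open>3 * t\<close> on the
  net; passing to the norm costs a factor 2 and removing the scales a factor 4.\<close>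

lemma estimate_accuracy:
  assumes n: "0 < n" and Z: "unitary_fun d Z" and V: "unitary_fun d V"
    and T: "\<And>v. v \<in> T \<Longrightarrow> sq d v = 1"
      "\<And>v. sq d v = 1 \<Longrightarrow> \<exists>w\<in>T. sq d (\<lambda>i. v i - w i) \<le> 1/16"
    and s: "1/2 \<le> s" "1/2 \<le> s'"
    and stZ: "\<And>u v. u \<in> T \<Longrightarrow> v \<in> T \<Longrightarrow> \<bar>S u v - real n * (s * Re (ip d u (mv d Z v)) + E u v)\<bar> \<le> real n * (3/2 * t)"
    and stV: "\<And>u v. u \<in> T \<Longrightarrow> v \<in> T \<Longrightarrow> \<bar>S u v - real n * (s' * Re (ip d u (mv d V v)) + E u v)\<bar> \<le> real n * (3/2 * t)"
    and v: "sq d v = 1"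
  shows "vn d (\<lambda>i. mv d Z v i - mv d V v i) \<le> 24 * t"
proof -
  define M where "M i j = of_real s * Z i j - of_real s' * V i j" for i j
  have M: "mv d M v = (\<lambda>i. of_real s * mv d Z v i - of_real s' * mv d V v i)" for v
    by (rule ext) (simp add: mv_def M_def algebra_simps sum_subtractf sum_distrib_left)
  have "Re (ip d u (mv d M v)) \<le> 3 * t" if "u \<in> T" "v \<in> T" for u v
  proof -
    have "ip d u (mv d M v) = of_real s * ip d u (mv d Z v) - of_real s' * ip d u (mv d V v)"
      unfolding M by (simp add: ip_def algebra_simps sum_subtractf sum_distrib_left)
    then have "Re (ip d u (mv d M v)) = s * Re (ip d u (mv d Z v)) - s' * Re (ip d u (mv d V v))"
      by simp
    then have "real n * Re (ip d u (mv d M v)) = real n * (s * Re (ip d u (mv d Z v)) + E u v)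
        - real n * (s' * Re (ip d u (mv d V v)) + E u v)"
      by (simp only: right_diff_distrib[symmetric]) simp
    also have "\<dots> \<le> real n * (3/2 * t) + real n * (3/2 * t)"
      using stZ[OF that] stV[OF that] by linarith
    also have "\<dots> = real n * (3 * t)" by simp
    finally show ?thesis using n by simp
  qed
  from mv_le_from_net[OF T this] have "vn d (mv d M v) \<le> 2 * (3 * t)" if "sq d v = 1" for v
    using that by blast
  from unitary_diff_le[OF Z V s this[unfolded M] v] show ?thesis by simp
qed

text \<open>The two sample-size conditions pay for a union over exp O(d^2) unitaries at constant
  accuracy and over exp O(d) pairs of vectors at accuracy \<epsilon>/24 with variance O(d). Both are
  of order d^2.\<close>

lemma tomography:
  assumes d: "0 < d" and \<epsilon>: "0 < \<epsilon>" and \<eta>: "0 < \<eta>" and n0: "0 < n"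
    and n1: "(36 * real (2 * d\<^sup>2) + ln (4 / \<eta>)) * (32 * C6) \<le> real n * (1/6)\<^sup>2"
    and n2: "(36 * real (4 * d) + ln (4 / \<eta>)) * (16 * C6 * real d) \<le> real n * (\<epsilon> / 24)\<^sup>2"
  obtains A where "wf_alg d A" "queries A = 2 * n" "\<And>Z. unitary_mat d Z \<Longrightarrow> fail_prob d Z A \<epsilon> \<le> \<eta>"
proof -
  define t where "t = \<epsilon> / 24"
  have t: "0 < t" "24 * t = \<epsilon>" using \<epsilon> by (auto simp: t_def)
  obtain U where U: "finite U" "\<And>W. W \<in> U \<Longrightarrow> unitary_fun d W" "real (card U) \<le> net_base ^ (2 * d\<^sup>2)"
    "\<And>Z. unitary_fun d Z \<Longrightarrow> \<exists>W\<in>U. 3/4 \<le> (cmod (hs d Z W))\<^sup>2 / (real d)\<^sup>2"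
    using unitary_net[OF d] by blast
  obtain T where T: "finite T" "\<And>v. v \<in> T \<Longrightarrow> sq d v = 1" "real (card T) \<le> net_base ^ (2 * d)"
    "\<And>v. sq d v = 1 \<Longrightarrow> \<exists>w\<in>T. sq d (\<lambda>i. v i - w i) \<le> 1/16"
    using unit_vector_net[OF d] by blast
  \<comment> \<open>The net supplies a mean of at least 7/4 + 2/d, and the deviation is at most 1/4,
    so some element passes this threshold. Conversely, passing forces a normalised squared overlap
    of at least 1/4.\<close>
  define ref where "ref xs = (SOME W. W \<in> U \<and>
      real n * (3/2 + 2 / real d) \<le> clamped_sum (96 * C6) (overlap_stat d W) xs)" for xs
  \<comment> \<open>The true scale is unknown beyond being at least 1/2, so it is quantified away;
    its phase is absorbed into \<open>V\<close>.\<close>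
  define fits where "fits xs ys V \<longleftrightarrow> unitary_fun d V \<and> (\<exists>s\<ge>1/2. \<forall>u\<in>T. \<forall>v\<in>T.
      \<bar>clamped_sum (8 * C6 * real d / t) (entry_stat d (ref xs) u v) ys - real n * (s * Re (ip d u (mv d V v))
         + (1 + 2 / real d) * Re (ip d u (mv d (ref xs) v)))\<bar> \<le> real n * (3/2 * t))" for xs ys V
  \<comment> \<open>The identity is a default for inconsistent data: the output must be unitary on
    every history.\<close>
  define est where "est xs ys = (if \<exists>V. fits xs ys V then SOME V. fits xs ys V else (\<lambda>i j. of_bool (i = j)))" for xs ys
  have est: "unitary_fun d (est xs ys)" for xs ys
  proof (cases "\<exists>V. fits xs ys V")
    case True
    then have "fits xs ys (est xs ys)" unfolding est_def by (simp add: someI_ex)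
    then show ?thesis by (simp add: fits_def)
  qed (simp add: est_def unitary_fun_id)
  define f where "f s = mat d d (case_prod (est (take n s) (drop n s)))" for s
  obtain A where A: "wf_alg d A" "queries A = n + n"
    "\<And>Z \<epsilon>. unitary_mat d Z \<Longrightarrow> fail_prob d Z A \<epsilon> =
       iid_prob (sample_space d) (sample_prob d (mfun Z)) (n + n) (\<lambda>s. pudist d Z (f s) > \<epsilon>)"
  proof (rule sampling_algorithm[OF d, of f "n + n"])
    show "unitary_mat d (f s)" for s unfolding f_def by (rule unitary_mat_of_fun[OF est])
  qed blast
  have "fail_prob d Z A \<epsilon> \<le> \<eta>" if ZU: "unitary_mat d Z" for Z
  proof -
    define z where "z = mfun Z"
    have Z: "unitary_fun d z" unfolding z_def by (rule unitary_fun_mfun[OF ZU])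
    define E1 where "E1 xs \<longleftrightarrow> (\<exists>W\<in>U. real n * (1/4) <
     \<bar>clamped_sum (96 * C6) (overlap_stat d W) xs
      - real n * ((cmod (hs d z W))\<^sup>2 / (real d)\<^sup>2 + 1 + 2 / real d)\<bar>)" for xs
    define E2 where "E2 xs ys \<longleftrightarrow> (\<exists>(u, v)\<in>T \<times> T. real n * (3/2 * t) <
     \<bar>clamped_sum (8 * C6 * real d / t) (entry_stat d (ref xs) u v) ys
      - real n * (Re (hs d z (ref xs) / of_nat d * ip d u (mv d z v))
           + (1 + 2 / real d) * Re (ip d u (mv d (ref xs) v)))\<bar>)" for xs ys
    have ref: "unitary_fun d (ref xs) \<and> 1/2 \<le> cmod (hs d z (ref xs) / of_nat d)" if E1: "\<not> E1 xs" for xs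
    proof -
      have close: "\<bar>clamped_sum (96 * C6) (overlap_stat d W) xs
        - real n * ((cmod (hs d z W))\<^sup>2 / (real d)\<^sup>2 + 1 + 2 / real d)\<bar> \<le> real n * (1/4)" if "W \<in> U" for W
        using E1 that by (auto simp: E1_def not_less)
      have "\<exists>W. W \<in> U \<and> real n * (3/2 + 2 / real d) \<le> clamped_sum (96 * C6) (overlap_stat d W) xs"
      proof -
        obtain W where W: "W \<in> U" "3/4 \<le> (cmod (hs d z W))\<^sup>2 / (real d)\<^sup>2" using U(4)[OF Z] by blast
        have "real n * (3/2 + 2 / real d) + real n * (1/4) = real n * (3/4 + 1 + 2 / real d)"
          by (simp add: algebra_simps)
        also have "\<dots> \<le> real n * ((cmod (hs d z W))\<^sup>2 / (real d)\<^sup>2 + 1 + 2 / real d)"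
          using W(2) by (intro mult_left_mono) auto
        finally show ?thesis using close[OF W(1)] W(1) by (intro exI[of _ W]) linarith
      qed
      then have r: "ref xs \<in> U" "real n * (3/2 + 2 / real d) \<le> clamped_sum (96 * C6) (overlap_stat d (ref xs)) xs"
        unfolding ref_def by (metis (mono_tags, lifting) someI_ex)+
      have "real n * (3/2 + 2 / real d) \<le> real n * ((cmod (hs d z (ref xs)))\<^sup>2 / (real d)\<^sup>2 + 1 + 2 / real d) + real n * (1/4)"
        using close[OF r(1)] r(2) by linarith
      also have "\<dots> = real n * ((cmod (hs d z (ref xs)))\<^sup>2 / (real d)\<^sup>2 + 1 + 2 / real d + 1/4)"
        by (simp add: algebra_simps)
      finally have "3/2 + 2 / real d \<le> (cmod (hs d z (ref xs)))\<^sup>2 / (real d)\<^sup>2 + 1 + 2 / real d + 1/4"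
        using n0 by (simp only: mult_le_cancel_left_pos of_nat_0_less_iff)
      then have "(1/2)\<^sup>2 \<le> (cmod (hs d z (ref xs)))\<^sup>2 / (real d)\<^sup>2"
        unfolding power2_eq_square[of "1/2"] by linarith
      then have "(1/2)\<^sup>2 \<le> (cmod (hs d z (ref xs) / of_nat d))\<^sup>2"
        by (simp only: norm_divide power_divide norm_of_nat)
      then have "1/2 \<le> cmod (hs d z (ref xs) / of_nat d)" by (rule power2_le_imp_le) simp
      then show ?thesis using U(2)[OF r(1)] by blast
    qed
    have good: "pudist d Z (f (xs @ ys)) \<le> \<epsilon>"
      if xs: "length xs = n" and E1: "\<not> E1 xs" and E2: "\<not> E2 xs ys" for xs ys
    proof -
      define R where "R = ref xs"
      define c where "c = hs d z R / of_nat d"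
      have c: "1/2 \<le> cmod c" using ref[OF E1] by (simp add: c_def R_def)
      define \<phi> where "\<phi> = c / of_real (cmod c)"
      have "c \<noteq> 0" using c by auto
      then have \<phi>: "cmod \<phi> = 1" "c = of_real (cmod c) * \<phi>" by (auto simp: \<phi>_def norm_divide)
      define z' where "z' i j = \<phi> * z i j" for i j
      have z': "unitary_fun d z'" unfolding z'_def using Z \<phi>(1) by (rule unitary_fun_phase)
      have Re_c: "Re (c * ip d u (mv d z v)) = cmod c * Re (ip d u (mv d z' v))" for u v
      proof -
        have "c * ip d u (mv d z v) = of_real (cmod c) * ip d u (mv d z' v)"
          unfolding z'_def mv_phase ip_scale_right by (subst \<phi>(2)) (simp only: mult.assoc)
        then show ?thesis by simp
      qed
      have stZ: "\<bar>clamped_sum (8 * C6 * real d / t) (entry_stat d R u v) ys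
         - real n * (cmod c * Re (ip d u (mv d z' v)) + (1 + 2 / real d) * Re (ip d u (mv d R v)))\<bar> \<le> real n * (3/2 * t)"
        if "u \<in> T" "v \<in> T" for u v
      proof -
        have "\<bar>clamped_sum (8 * C6 * real d / t) (entry_stat d R u v) ys
         - real n * (Re (c * ip d u (mv d z v)) + (1 + 2 / real d) * Re (ip d u (mv d R v)))\<bar> \<le> real n * (3/2 * t)"
          unfolding not_less[symmetric] c_def R_def using E2 that unfolding E2_def by blast
        then show ?thesis by (simp only: Re_c)
      qed
      \<comment> \<open>The phase-rotated true unitary fits the data with scale
        \<open>cmod c\<close>, so the search succeeds and returns a unitary with the same
        approximate entries up to scale.\<close>
      have "fits xs ys z'" unfolding fits_def using z' c stZ unfolding R_def by blast
      then have "\<exists>V. fits xs ys V" by blast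
      then have "fits xs ys (est xs ys)" unfolding est_def by (simp add: someI_ex)
      then obtain s where s: "1/2 \<le> s" and stV: "\<And>u v. u \<in> T \<Longrightarrow> v \<in> T \<Longrightarrow>
        \<bar>clamped_sum (8 * C6 * real d / t) (entry_stat d R u v) ys
         - real n * (s * Re (ip d u (mv d (est xs ys) v)) + (1 + 2 / real d) * Re (ip d u (mv d R v)))\<bar> \<le> real n * (3/2 * t)"
        unfolding fits_def R_def by blast
      have acc: "vn d (\<lambda>i. mv d z' v i - mv d (est xs ys) v i) \<le> \<epsilon>" if "sq d v = 1" for v
        using estimate_accuracy[OF n0 z' est T(2,4) c s stZ stV that] t(2) by simp
      have fm: "f (xs @ ys) = mat d d (case_prod (est xs ys))" by (simp add: f_def xs)
      have mvf: "mv d (mfun (f (xs @ ys))) v i = mv d (est xs ys) v i" if "i < d" for v i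
        using that by (simp add: mv_def mfun_def fm)
      show ?thesis
      proof (rule pudist_le[OF d _ _ \<phi>(1)])
        fix v assume v: "sq d v = 1"
        have "vn d (\<lambda>i. \<phi> * mv d (mfun Z) v i - mv d (mfun (f (xs @ ys))) v i)
           = vn d (\<lambda>i. mv d z' v i - mv d (est xs ys) v i)"
          unfolding z'_def mv_phase by (simp add: vn_sqrt sq_def mvf z_def)
        then show "vn d (\<lambda>i. \<phi> * mv d (mfun Z) v i - mv d (mfun (f (xs @ ys))) v i) \<le> \<epsilon>"
          using acc[OF v] by simp
      qed (use ZU in \<open>auto simp: unitary_mat_def fm\<close>)
    qed
    have "iid_prob (sample_space d) (sample_prob d z) (n + n) (\<lambda>s. pudist d Z (f s) > \<epsilon>) \<le> \<eta> / 2 + \<eta> / 2"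
    proof (rule iid_prob_two_stage[OF sample_prob_nonneg sum_sample_prob_1[OF Z d], where ?E1.0 = E1 and ?E2.0 = E2])
      show "iid_prob (sample_space d) (sample_prob d z) n E1 \<le> \<eta> / 2"
        unfolding E1_def by (rule reference_stage[OF d U(1,2,3) \<eta> n1 Z])
      show "iid_prob (sample_space d) (sample_prob d z) n (E2 xs) \<le> \<eta> / 2" if "\<not> E1 xs" for xs
        unfolding E2_def
        by (rule entry_stage[OF d T(1,2,3) \<eta> t(1) _ Z]) (use n2 ref[OF that] in \<open>auto simp: t_def\<close>)
      show "E1 xs \<or> E2 xs ys" if "xs \<in> tuples (sample_space d) n" "pudist d Z (f (xs @ ys)) > \<epsilon>" for xs ys
        using good[of xs ys] that by (auto simp: tuples_def)
    qed (use \<eta> in auto)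
    then show ?thesis using A(3)[OF ZU] by (simp add: z_def)
  qed
  then show thesis using that A(1,2) by simp
qed

text \<open>For large \<open>\<epsilon>\<close> the query budget can fall below 1, so an algorithm
  without queries is needed; any two unitaries are within distance 2.\<close>

lemma trivial_algorithm:
  assumes d: "0 < d" and "2 \<le> \<epsilon>"
  obtains A where "wf_alg d A" "queries A = 0" "\<And>Z. unitary_mat d Z \<Longrightarrow> fail_prob d Z A \<epsilon> = 0"
proof -
  have I: "unitary_mat d (mat d d (\<lambda>(i, j). of_bool (i = j)))"
    using unitary_mat_of_fun[OF unitary_fun_id] .
  obtain A where A: "wf_alg d A" "queries A = 0"
    "\<And>Z \<epsilon>. unitary_mat d Z \<Longrightarrow> fail_prob d Z A \<epsilon> =
       iid_prob (sample_space d) (sample_prob d (mfun Z)) 0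
         (\<lambda>s. pudist d Z (mat d d (\<lambda>(i, j). of_bool (i = j))) > \<epsilon>)"
    using sampling_algorithm[OF d, of "\<lambda>_. mat d d (\<lambda>(i, j). of_bool (i = j))" 0] I by blast
  have "fail_prob d Z A \<epsilon> = 0" if "unitary_mat d Z" for Z
    using pudist_le_2[OF d that I] A(3)[OF that, of \<epsilon>] assms(2) by (simp add: iid_prob_def)
  then show thesis using that A by blast
qed

theorem mainTheorem5:
  shows "\<exists>C>0. \<forall>d::nat. \<forall>\<epsilon> \<eta>::real. d \<ge> 1 \<longrightarrow> 0 < \<epsilon> \<longrightarrow> 0 < \<eta> \<longrightarrow> \<eta> \<le> 1/2 \<longrightarrow>
     (\<exists>A. wf_alg d A \<and>
          real (queries A) \<le> C * (real d)^2 / \<epsilon>^2 * ln (1/\<eta>) \<and>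
          (\<forall>Z. unitary_mat d Z \<longrightarrow> fail_prob d Z A \<epsilon> \<le> \<eta>))"
proof -
  \<comment> \<open>Here 9216 = 16 * 24^2 and 291 comes from \<open>k2\<close>, so the second
    sample-size condition holds with equality at \<open>C0 * q\<close> samples; the first has room
    to spare.\<close>
  define C0 where "C0 = 9216 * 291 * C6"
  have C0: "0 < C0" by (simp add: C0_def)
  have "\<exists>A. wf_alg d A \<and> real (queries A) \<le> (2 * C0 + 16) * (real d)^2 / \<epsilon>^2 * ln (1/\<eta>) \<and>
          (\<forall>Z. unitary_mat d Z \<longrightarrow> fail_prob d Z A \<epsilon> \<le> \<eta>)"
    if d: "d \<ge> 1" and \<epsilon>: "0 < \<epsilon>" and \<eta>: "0 < \<eta>" "\<eta> \<le> 1/2" for d :: nat and \<epsilon> \<eta> :: real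
  proof (cases "2 \<le> \<epsilon>")
    case True
    obtain A where A: "wf_alg d A" "queries A = 0" "\<And>Z. unitary_mat d Z \<Longrightarrow> fail_prob d Z A \<epsilon> = 0"
      using trivial_algorithm[of d \<epsilon>] d True by auto
    have "0 \<le> ln (1 / \<eta>)" using \<eta> by simp
    then show ?thesis using A \<eta> C0 by (intro exI[of _ A]) auto
  next
    case False
    define l where "l = ln (1 / \<eta>)"
    define q where "q = (real d)\<^sup>2 / \<epsilon>\<^sup>2 * l"
    \<comment> \<open>Since \<open>\<eta>\<close> is at most 1/2, the logarithm is bounded away from
      zero and can absorb additive constants.\<close>
    have "ln 2 \<le> l" unfolding l_def using \<eta> by (subst ln_le_cancel_iff) (auto simp: field_simps)
    moreover have "1/2 \<le> ln (2::real)" using ln_ge_iff[of 2 "1/2"] exp_bound_half[of "1/2 :: real"] by simp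
    ultimately have l: "1/2 \<le> l" "ln 2 \<le> l" by auto
    have ln4: "ln (4 / \<eta>) \<le> 3 * l"
    proof -
      have "ln (4 / \<eta>) = ln (2 * 2) + l" using \<eta> ln_mult[of 4 "1 / \<eta>"] by (simp add: l_def)
      also have "\<dots> = 2 * ln 2 + l" by (subst ln_mult) auto
      finally show ?thesis using l by simp
    qed
    have d2: "1 \<le> (real d)\<^sup>2" using d by simp
    have "\<epsilon>\<^sup>2 \<le> 2\<^sup>2" using False \<epsilon> by (intro power_mono) auto
    then have e2: "0 < \<epsilon>\<^sup>2" "\<epsilon>\<^sup>2 \<le> 4" using \<epsilon> by auto
    have qe: "q * \<epsilon>\<^sup>2 = (real d)\<^sup>2 * l" using e2 by (simp add: q_def)
    have q4: "(real d)\<^sup>2 * l \<le> 4 * q"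
    proof -
      have "0 \<le> q" using l by (simp add: q_def)
      then have "q * \<epsilon>\<^sup>2 \<le> q * 4" using e2 by (intro mult_left_mono)
      then show ?thesis using qe by simp
    qed
    \<comment> \<open>The lower bound on \<open>q\<close> lets the rounding error of two batches, at
      most 2, be charged to the extra \<open>16 * q\<close>.\<close>
    have "1 * (1/2) \<le> (real d)\<^sup>2 * l" using d2 l by (intro mult_mono) auto
    then have q8: "1/8 \<le> q" using q4 by simp
    define n where "n = nat \<lceil>C0 * q\<rceil>"
    have "0 < C0 * q" using C0 q8 by simp
    then have n: "C0 * q \<le> real n" "real n \<le> C0 * q + 1" "0 < n" unfolding n_def by linarith+
    have k1: "36 * real (2 * d\<^sup>2) + ln (4 / \<eta>) \<le> 147 * ((real d)\<^sup>2 * l)"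
    proof -
      have "72 * (real d)\<^sup>2 * 1 \<le> 72 * (real d)\<^sup>2 * (2 * l)" using l by (intro mult_left_mono) auto
      moreover have "3 * l * 1 \<le> 3 * l * (real d)\<^sup>2" using d2 l by (intro mult_left_mono) auto
      ultimately show ?thesis using ln4 by (simp add: mult.commute[of l])
    qed
    have k2: "(36 * real (4 * d) + ln (4 / \<eta>)) * real d \<le> 291 * ((real d)\<^sup>2 * l)"
    proof -
      have "144 * real d * 1 \<le> 144 * real d * (2 * l)" using l by (intro mult_left_mono) auto
      moreover have "3 * l * 1 \<le> 3 * l * real d" using d l by (intro mult_left_mono) auto
      ultimately have "36 * real (4 * d) + ln (4 / \<eta>) \<le> 291 * (real d * l)"
        using ln4 by (simp add: mult.commute[of l])
      then have "(36 * real (4 * d) + ln (4 / \<eta>)) * real d \<le> 291 * (real d * l) * real d"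
        by (intro mult_right_mono) auto
      then show ?thesis by (simp add: power2_eq_square mult_ac)
    qed
    have "(36 * real (2 * d\<^sup>2) + ln (4 / \<eta>)) * (32 * C6) \<le> (147 * (4 * q)) * (32 * C6)"
      using k1 q4 by (intro mult_right_mono) (auto intro: order.trans less_imp_le)
    also have "\<dots> \<le> C0 * q * (1/6)\<^sup>2"
    proof -
      have "0 \<le> C6 * q" using q8 less_imp_le[OF C6_pos] by (intro mult_nonneg_nonneg) auto
      then show ?thesis using q8 by (simp add: C0_def power2_eq_square mult_ac)
    qed
    also have "\<dots> \<le> real n * (1/6)\<^sup>2" using n by (intro mult_right_mono) auto
    finally have n1: "(36 * real (2 * d\<^sup>2) + ln (4 / \<eta>)) * (32 * C6) \<le> real n * (1/6)\<^sup>2" .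
    have "(36 * real (4 * d) + ln (4 / \<eta>)) * (16 * C6 * real d)
       = ((36 * real (4 * d) + ln (4 / \<eta>)) * real d) * (16 * C6)" by (simp only: mult_ac)
    also have "\<dots> \<le> (291 * (q * \<epsilon>\<^sup>2)) * (16 * C6)"
      unfolding qe using k2 by (intro mult_right_mono) (auto intro: less_imp_le)
    also have "\<dots> = C0 * q * (\<epsilon> / 24)\<^sup>2" by (simp add: C0_def power_divide)
    also have "\<dots> \<le> real n * (\<epsilon> / 24)\<^sup>2" using n by (intro mult_right_mono) auto
    finally have n2: "(36 * real (4 * d) + ln (4 / \<eta>)) * (16 * C6 * real d) \<le> real n * (\<epsilon> / 24)\<^sup>2" .
    obtain A where A: "wf_alg d A" "queries A = 2 * n" "\<And>Z. unitary_mat d Z \<Longrightarrow> fail_prob d Z A \<epsilon> \<le> \<eta>"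
      using tomography[OF _ \<epsilon> \<eta>(1) n(3) n1 n2] d by auto
    have "real (queries A) \<le> 2 * (C0 * q + 1)" using A(2) n by simp
    also have "\<dots> \<le> (2 * C0 + 16) * q" using q8 by (simp add: algebra_simps)
    also have "\<dots> = (2 * C0 + 16) * (real d)^2 / \<epsilon>^2 * ln (1/\<eta>)" by (simp add: q_def l_def)
    finally show ?thesis using A by blast
  qed
  then show ?thesis using C0 by (intro exI[of _ "2 * C0 + 16"]) auto
qed

end
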